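(* Let $a>0$, let $\Omega=(-a,a)^3\subset\mathbb{R}^3$, and let $T=\mathrm{diam}\,\Omega=2\sqrt3\,a$. Let $f\in C_0^2(\Omega)$ (extended by zero to $\mathbb{R}^3$), and for $y\in\partial\Omega$, $r\ge0$, let $$M(y,r)=\frac{1}{4\pi}\int_{S^2}f(y+r\omega)\,d\omega$$ be its spherical means with centers on $\partial\Omega$. Then $f$ can be reconstructed from $M$ by the following formula: for every $x\in\Omega$, $$f(x)=\frac{1}{2\pi}\,\operatorname{div}_x\sum_{j=1}^{6}\ \int\limits_{(\Pi_j^a\cup\Pi_j^b)\cap B(x,T)} n_j\left.\left(\frac1t\,\frac{\partial}{\partial t}\bigl(t\,M_j^{\mathrm{repl}}(y,t)\bigr)\right)\right|_{t=|x-y|}ds(y),$$ where the planes $\Pi_j^a,\Pi_j^b$, the normals $n_j$ and the replicated means $M_j^{\mathrm{repl}}$ are as defined in the context.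
   Context: $C_0^2(\Omega)$ denotes the twice continuously differentiable functions with compact support in $\Omega$. $S^2$ is the unit sphere in $\mathbb{R}^3$, $B(x,T)$ is the ball of radius $T$ centered at $x$, and $ds(y)$ is the standard area element. Faces, normals and planes: the six faces of the cube $\Omega$ are $S_1,\dots,S_6$. Each face lies in a plane $\{x_i=\sigma a\}$ for some $i\in\{1,2,3\}$ and $\sigma\in\{+1,-1\}$. If $S_j$ is the face lying in $\{x_i=\sigma a\}$, then $n_j=\sigma e_i$ is the exterior unit normal to $S_j$ ($e_i$ being the $i$-th standard basis vector), $\Pi_j^a=\{x_i=\sigma a\}$ is the plane containing $S_j$, and $\Pi_j^b=\{x_i=-3\sigma a\}$ (the mirror image of $\Pi_j^a$ in the plane of the face opposite to $S_j$). Both planes are equipped with the same normal $n_j$. Replication operator: $E^{2D}$ extends a function $h$ defined on the open square $(-a,a)\times(-a,a)$ to a function $h^{\mathrm{repl}}=E^{2D}h$ on $\mathbb{R}^2$ by odd reflections: for $n,m\in\mathbb{Z}$ and $(\xi_1,\xi_2)$ in the open square of side $2a$ centered at $(2na,2ma)$, $$h^{\mathrm{repl}}(\xi_1,\xi_2)=(-1)^{m+n}h\bigl((-1)^n(\xi_1-2na),\,(-1)^m(\xi_2-2ma)\bigr),$$ and $h^{\mathrm{repl}}=0$ on the boundaries of all these squares. Replicated means: for each $t$, $M_j^{\mathrm{repl}}(\cdot,\cdot,t)=E^{2D}\bigl(M(\cdot,t)|_{S_j}\bigr)$, where $M(\cdot,t)|_{S_j}$ is regarded as a function on $(-a,a)^2$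 of the two coordinates other than $x_i$. For $y\in\Pi_j^a\cup\Pi_j^b$, $M_j^{\mathrm{repl}}(y,t)$ denotes the value of $M_j^{\mathrm{repl}}(\cdot,\cdot,t)$ at the two coordinates of $y$ other than $y_i$ (so the same replicated means are placed on both planes). *)

theory Defs
  imports "HOL-Analysis.Analysis"
begin

definition cube :: "real \<Rightarrow> (real^3) set" where
  "cube a = {x. \<forall>i. \<bar>x $ i\<bar> < a}"

definition C2_on :: "('a::real_normed_vector \<Rightarrow> 'b::real_normed_vector) \<Rightarrow> 'a set \<Rightarrow> bool" where
  "C2_on f S \<longleftrightarrow>
     (\<exists>(f' :: 'a \<Rightarrow> 'a \<Rightarrow>\<^sub>L 'b) (f'' :: 'a \<Rightarrow> 'a \<Rightarrow>\<^sub>L 'a \<Rightarrow>\<^sub>L 'b).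
        (\<forall>x\<in>S. (f has_derivative blinfun_apply (f' x)) (at x)) \<and>
        (\<forall>x\<in>S. (f' has_derivative blinfun_apply (f'' x)) (at x)) \<and>
        continuous_on S f'')"

text \<open>Membership in \<open>C\<^sub>0\<^sup>2(\<Omega>)\<close>, for functions that are already extended by zero to the whole
  space: the support, as a closed subset of the whole space, lies in \<open>\<Omega>\<close>.\<close>

definition C2_compact_support :: "('a::real_normed_vector \<Rightarrow> 'b::real_normed_vector) \<Rightarrow> 'a set \<Rightarrow> bool" where
  "C2_compact_support f S \<longleftrightarrow>
     C2_on f S \<and> compact (closure {x. f x \<noteq> 0}) \<and> closure {x. f x \<noteq> 0} \<subseteq> S"

text \<open>Area measure of the unit sphere, as a measure on the whole space: the image under spherical
  coordinates (polar angle \<open>\<theta>\<close>, azimuth \<open>\<phi>\<close>) of the area element \<open>sin \<theta> d\<theta> d\<phi>\<close>.\<close>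

definition sphere_point :: "real \<times> real \<Rightarrow> real^3" where
  "sphere_point = (\<lambda>(\<theta>, \<phi>). vector [sin \<theta> * cos \<phi>, sin \<theta> * sin \<phi>, cos \<theta>])"

definition sphere_area :: "(real^3) measure" where
  "sphere_area =
     distr (density lborel
              (\<lambda>(\<theta>, \<phi>). ennreal (indicator ({0..pi} \<times> {0..2 * pi}) (\<theta>, \<phi>) * sin \<theta>)))
           borel sphere_point"

lemma continuous_on_vector_3:
  fixes u v w :: "'a::topological_space \<Rightarrow> real"
  assumes "continuous_on S u" "continuous_on S v" "continuous_on S w"
  shows "continuous_on S (\<lambda>p. vector [u p, v p, w p] :: real^3)"
proof -
  have eq: "(\<lambda>p. vector [u p, v p, w p] :: real^3) =
      (\<lambda>p. \<chi> i. if i = 1 then u p else if i = 2 then v p else w p)"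
    by (auto simp: vec_eq_iff forall_3)
  have "continuous_on S (\<lambda>p. if i = 1 then u p else if i = 2 then v p else w p)" for i :: 3
    using assms by (cases "i = 1"; cases "i = 2") auto
  then show ?thesis
    unfolding eq by (rule continuous_on_vec_lambda)
qed

lemma sphere_point_measurable [measurable]: "sphere_point \<in> borel_measurable borel"
  unfolding sphere_point_def case_prod_unfold
  by (intro borel_measurable_continuous_onI continuous_on_vector_3 continuous_intros)

definition spherical_mean :: "(real^3 \<Rightarrow> real) \<Rightarrow> real^3 \<Rightarrow> real \<Rightarrow> real" where
  "spherical_mean f y r = 1 / (4 * pi) * (LINT \<omega>|sphere_area. f (y + r *\<^sub>R \<omega>))"

text \<open>The two coordinates other than the \<open>i\<close>-th one are always taken in increasing order.\<close>

definition other_coords :: "3 \<Rightarrow> real^3 \<Rightarrow> real \<times> real" where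
  "other_coords i y =
     (if i = 1 then (y $ 2, y $ 3) else if i = 2 then (y $ 1, y $ 3) else (y $ 1, y $ 2))"

definition plane_point :: "3 \<Rightarrow> real \<Rightarrow> real \<times> real \<Rightarrow> real^3" where
  "plane_point i c = (\<lambda>(u, v).
     if i = 1 then vector [c, u, v] else if i = 2 then vector [u, c, v] else vector [u, v, c])"

definition coord_plane :: "3 \<Rightarrow> real \<Rightarrow> (real^3) set" where
  "coord_plane i c = {y. y $ i = c}"

lemma plane_point_nth [simp]: "plane_point i c \<xi> $ i = c"
  using exhaust_3 [of i] by (cases \<xi>) (auto simp: plane_point_def)

lemma other_coords_plane_point [simp]: "other_coords i (plane_point i c \<xi>) = \<xi>"
  using exhaust_3 [of i] by (cases \<xi>) (auto simp: plane_point_def other_coords_def)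

lemma plane_point_other_coords: "y \<in> coord_plane i c \<Longrightarrow> plane_point i c (other_coords i y) = y"
  using exhaust_3 [of i]
  by (auto simp: plane_point_def other_coords_def coord_plane_def vec_eq_iff forall_3)

lemma plane_point_measurable [measurable]: "plane_point i c \<in> borel_measurable borel"
  unfolding plane_point_def case_prod_unfold
  by (cases "i = 1"; cases "i = 2")
    (auto intro!: borel_measurable_continuous_onI continuous_on_vector_3 continuous_intros)

definition plane_area :: "3 \<Rightarrow> real \<Rightarrow> (real^3) measure" where
  "plane_area i c = distr lborel borel (plane_point i c)"

text \<open>The open squares of side \<open>2 * a\<close> centred at \<open>(2 * n * a, 2 * m * a)\<close> are disjoint, so a point
  in one of them determines \<open>n\<close> and \<open>m\<close>; the floor expressions compute them. The two lemmas below
  give the defining properties.\<close>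

definition E2D :: "real \<Rightarrow> (real \<times> real \<Rightarrow> real) \<Rightarrow> real \<times> real \<Rightarrow> real" where
  "E2D a h = (\<lambda>(\<xi>\<^sub>1, \<xi>\<^sub>2).
     let n = \<lfloor>(\<xi>\<^sub>1 + a) / (2 * a)\<rfloor>; m = \<lfloor>(\<xi>\<^sub>2 + a) / (2 * a)\<rfloor> in
     if \<bar>\<xi>\<^sub>1 - 2 * of_int n * a\<bar> < a \<and> \<bar>\<xi>\<^sub>2 - 2 * of_int m * a\<bar> < a
     then (-1) powi (m + n) *
          h ((-1) powi n * (\<xi>\<^sub>1 - 2 * of_int n * a), (-1) powi m * (\<xi>\<^sub>2 - 2 * of_int m * a))
     else 0)"

lemma square_index:
  fixes n :: int
  assumes "a > 0" and "\<bar>\<xi> - 2 * of_int n * a\<bar> < a"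
  shows "\<lfloor>(\<xi> + a) / (2 * a)\<rfloor> = n"
  using assms by (intro floor_unique) (auto simp: field_simps abs_less_iff)

lemma E2D_square:
  fixes n m :: int
  assumes "a > 0" and "\<bar>\<xi>\<^sub>1 - 2 * of_int n * a\<bar> < a" and "\<bar>\<xi>\<^sub>2 - 2 * of_int m * a\<bar> < a"
  shows "E2D a h (\<xi>\<^sub>1, \<xi>\<^sub>2) = (-1) powi (m + n) *
           h ((-1) powi n * (\<xi>\<^sub>1 - 2 * of_int n * a), (-1) powi m * (\<xi>\<^sub>2 - 2 * of_int m * a))"
  using assms square_index [OF assms(1,2)] square_index [OF assms(1,3)]
  by (simp add: E2D_def)

lemma E2D_outside_squares:
  assumes "\<not> (\<exists>n m :: int. \<bar>\<xi>\<^sub>1 - 2 * of_int n * a\<bar> < a \<and> \<bar>\<xi>\<^sub>2 - 2 * of_int m * a\<bar> < a)"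
  shows "E2D a h (\<xi>\<^sub>1, \<xi>\<^sub>2) = 0"
  using assms by (auto simp: E2D_def Let_def)

text \<open>The face of the cube lying in the plane \<open>y $ i = \<sigma> * a\<close>, with \<open>\<sigma> = 1\<close> or \<open>\<sigma> = -1\<close>, is
  indexed by the pair \<open>(i, \<sigma>)\<close>.\<close>

definition face_normal :: "3 \<Rightarrow> real \<Rightarrow> real^3" where
  "face_normal i \<sigma> = \<sigma> *\<^sub>R axis i 1"

definition replicated_mean ::
    "real \<Rightarrow> (real^3 \<Rightarrow> real) \<Rightarrow> 3 \<Rightarrow> real \<Rightarrow> real^3 \<Rightarrow> real \<Rightarrow> real" where
  "replicated_mean a f i \<sigma> y t =
     E2D a (\<lambda>\<eta>. spherical_mean f (plane_point i (\<sigma> * a) \<eta>) t) (other_coords i y)"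

definition mean_kernel ::
    "real \<Rightarrow> (real^3 \<Rightarrow> real) \<Rightarrow> 3 \<Rightarrow> real \<Rightarrow> real^3 \<Rightarrow> real \<Rightarrow> real" where
  "mean_kernel a f i \<sigma> y t = 1 / t * deriv (\<lambda>s. s * replicated_mean a f i \<sigma> y s) t"

text \<open>The integral over the union of the two distinct parallel planes is the sum over \<open>c\<close> of the
  integrals over the planes \<open>y $ i = c\<close>.\<close>

definition plane_potential :: "real \<Rightarrow> (real^3 \<Rightarrow> real) \<Rightarrow> real^3 \<Rightarrow> real^3" where
  "plane_potential a f x =
     (\<Sum>(i, \<sigma>) \<in> UNIV \<times> {1, -1}. \<Sum>c \<in> {\<sigma> * a, - 3 * \<sigma> * a}.
        (LINT y : coord_plane i c \<inter> ball x (diameter (cube a)) | plane_area i c.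
           mean_kernel a f i \<sigma> y (dist x y) *\<^sub>R face_normal i \<sigma>))"

definition partial_differentiable :: "(real^'n \<Rightarrow> real) \<Rightarrow> 'n \<Rightarrow> real^'n \<Rightarrow> bool" where
  "partial_differentiable g i x \<longleftrightarrow> (\<lambda>s. g (x + s *\<^sub>R axis i 1)) differentiable (at 0)"

definition partial_deriv :: "(real^'n \<Rightarrow> real) \<Rightarrow> 'n \<Rightarrow> real^'n \<Rightarrow> real" where
  "partial_deriv g i x = deriv (\<lambda>s. g (x + s *\<^sub>R axis i 1)) 0"

definition divergence :: "(real^'n \<Rightarrow> real^'n) \<Rightarrow> real^'n \<Rightarrow> real" where
  "divergence F x = (\<Sum>i\<in>UNIV. partial_deriv (\<lambda>z. F z $ i) i x)"

lemma diameter_cube: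
  assumes "a > 0"
  shows "diameter (cube a) = 2 * sqrt 3 * a"
proof -
  let ?l = "vec (- a) :: real^3" and ?u = "vec a :: real^3"
  have box: "cube a = box ?l ?u"
    by (auto simp: cube_def mem_box_cart abs_less_iff) (metis minus_less_iff)+
  have "?l \<in> cbox ?l ?u" "?u \<in> cbox ?l ?u" and ne: "box ?l ?u \<noteq> {}"
    using assms by (auto simp: mem_box_cart interval_ne_empty_cart)
  have "diameter (cube a) = diameter (closure (cube a))"
    by (rule diameter_closure [symmetric]) (simp add: box)
  also have "\<dots> = diameter (cbox ?l ?u)"
    using ne by (simp add: box closure_box)
  also have "\<dots> = dist ?l ?u"
    using assms by (intro diameter_cbox) (auto simp: Basis_vec_def inner_axis)
  also have "\<dots> = sqrt (3 * (2 * a)\<^sup>2)"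
    by (simp add: dist_vec_def L2_set_def sum_3 dist_real_def)
  also have "\<dots> = 2 * sqrt 3 * a"
    using assms by (simp only: real_sqrt_mult real_sqrt_abs)
  finally show ?thesis .
qed

end

theory Submission
  imports Defs
begin

text \<open>
  Let \<open>u t y = t * M y t\<close>, the solution of the wave equation with \<open>u = 0\<close> and \<open>\<partial>\<^sub>t u = f\<close> at
  \<open>t = 0\<close>. For every centre \<open>p\<close> and every \<open>\<tau>\<close>, the field
  \<open>\<nabla>u / r + (y - p) (u / r\<^sup>3 - \<partial>\<^sub>t u / r\<^sup>2)\<close>, with \<open>r = \<bar>y - p\<bar>\<close> and \<open>u\<close> taken at the advanced time
  \<open>\<tau> + r\<close>, is divergence free away from \<open>p\<close>, and its flux through the boundary of the cube is
  \<open>4 \<pi> u \<tau> p\<close> if \<open>p\<close> lies in the cube and \<open>0\<close> if \<open>p\<close> lies outside (Kirchhoff). Add up these identities,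
  with alternating signs, over the images of \<open>x\<close> under the reflections in the planes of the faces. On
  each face the gradient terms of two images that are mirror images in that face cancel while the
  other terms double. Since \<open>u\<close> vanishes on the closed cube after the time \<open>diam \<Omega>\<close>, only finitely many images
  matter, and in the direction normal to the face only two pairs survive: they are the planes
  \<open>\<sigma> a\<close> and \<open>-3 \<sigma> a\<close>. The images in the lateral directions are traded for the
  replicated means. Differentiating at \<open>\<tau> = 0\<close> gives the formula.
\<close>

section \<open>Symmetry of the second derivative and averages over the sphere\<close>

text \<open>At \<tau> = 0 the flux identity only evaluates u = 0, so it is needed on a whole
  interval of \<tau>; the bound \<bar>\<tau>\<bar> \<le> a/2 is affordable because 4a - a/2 still
  exceeds the diameter 2 sqrt 3 a. The plane -3\<sigma>a arises by moving data instead of points: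
  the image x + 4\<sigma>a e_i of x sees the face in x_i = \<sigma>a at the same offset at which x
  itself sees the plane x_i = -3\<sigma>a, so the same means are placed there. Lateral reflections
  preserve distances. A face seen from a laterally reflected image is therefore a reflected copy of
  the face seen from x, and the alternating signs of the images become the signs of the replication.
  The divergence comes from one identity. With r the distance and d the offset from x to a plane
  along its axis, the derivative of \<partial>_t u(r)/r with respect to d is -d times the
  \<tau>-derivative at 0 of u(\<tau>+r)/r^3 - \<partial>_t u(\<tau>+r)/r^2. Since d decreases at
  unit rate as x_i grows, the differentiated flux is the x_i-derivative of a layer potential with
  density (1/t) \<partial>_t(t M).\<close>

lemma mixed_difference_mvt:
  fixes f :: "'a::real_normed_vector \<Rightarrow> real"
  assumes f1: "\<And>x. (f has_derivative blinfun_apply (f1 x)) (at x)"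
    and f2: "\<And>x. (f1 has_derivative blinfun_apply (f2 x)) (at x)"
    and "s > 0"
  shows "\<exists>\<alpha> \<beta>. 0 < \<alpha> \<and> \<alpha> < s \<and> 0 < \<beta> \<and> \<beta> < s \<and>
    f (z + s *\<^sub>R u + s *\<^sub>R v) - f (z + s *\<^sub>R u) - f (z + s *\<^sub>R v) + f z =
      s\<^sup>2 * f2 (z + \<alpha> *\<^sub>R u + \<beta> *\<^sub>R v) v u"
proof -
  define \<phi> where "\<phi> \<alpha> = f (z + \<alpha> *\<^sub>R u + s *\<^sub>R v) - f (z + \<alpha> *\<^sub>R u)" for \<alpha>
  have line: "((\<lambda>h. w + h *\<^sub>R e) has_derivative (\<lambda>h. h *\<^sub>R e)) (at \<alpha>)" for w e :: 'a and \<alpha>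
    by (auto intro!: derivative_eq_intros)
  have d: "((\<lambda>\<alpha>. f (w + \<alpha> *\<^sub>R u)) has_real_derivative f1 (w + \<alpha> *\<^sub>R u) u) (at \<alpha>)" for w \<alpha>
    using has_derivative_compose [OF line f1, of w u]
    by (simp add: has_field_derivative_def blinfun.scaleR_right mult_commute_abs)
  have d2: "((\<lambda>\<beta>. f1 (w + \<beta> *\<^sub>R v) u) has_real_derivative f2 (w + \<beta> *\<^sub>R v) v u) (at \<beta>)" for w \<beta>
    using bounded_linear.has_derivative
      [OF blinfun.bounded_linear_left has_derivative_compose [OF line f2], of w v u]
    by (simp add: has_field_derivative_def blinfun.scaleR_right blinfun.scaleR_left mult_commute_abs)
  have "(\<phi> has_real_derivative
      (f1 (z + \<alpha> *\<^sub>R u + s *\<^sub>R v) u - f1 (z + \<alpha> *\<^sub>R u) u)) (at \<alpha>)" for \<alpha>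
    unfolding \<phi>_def using DERIV_diff [OF d [of "z + s *\<^sub>R v" \<alpha>] d [of z \<alpha>]]
    by (simp add: algebra_simps)
  from MVT2 [OF \<open>s > 0\<close> this] obtain \<alpha> where \<alpha>: "0 < \<alpha>" "\<alpha> < s"
    and \<phi>: "\<phi> s - \<phi> 0 = s * (f1 (z + \<alpha> *\<^sub>R u + s *\<^sub>R v) u - f1 (z + \<alpha> *\<^sub>R u) u)"
    by auto
  from MVT2 [OF \<open>s > 0\<close> d2 [of "z + \<alpha> *\<^sub>R u"]] obtain \<beta> where \<beta>: "0 < \<beta>" "\<beta> < s"
    and "f1 (z + \<alpha> *\<^sub>R u + s *\<^sub>R v) u - f1 (z + \<alpha> *\<^sub>R u) u =
      s * f2 (z + \<alpha> *\<^sub>R u + \<beta> *\<^sub>R v) v u"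
    by auto
  with \<phi> have "\<phi> s - \<phi> 0 = s\<^sup>2 * f2 (z + \<alpha> *\<^sub>R u + \<beta> *\<^sub>R v) v u"
    by (simp add: power2_eq_square)
  moreover have "\<phi> s - \<phi> 0 =
      f (z + s *\<^sub>R u + s *\<^sub>R v) - f (z + s *\<^sub>R u) - f (z + s *\<^sub>R v) + f z"
    by (simp add: \<phi>_def)
  ultimately show ?thesis using \<alpha> \<beta> by metis
qed

text \<open>The mixed second difference does not see the order of \<open>u\<close> and
  \<open>v\<close>, while the mean value theorem writes it as \<open>s\<^sup>2\<close> times either
  mixed derivative at a nearby point; continuity closes the gap as \<open>s\<close> tends to
  0.\<close>

lemma second_derivative_symmetric:
  fixes f :: "'a::real_normed_vector \<Rightarrow> real"
  assumes f1: "\<And>x. (f has_derivative blinfun_apply (f1 x)) (at x)"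
    and f2: "\<And>x. (f1 has_derivative blinfun_apply (f2 x)) (at x)"
    and cont: "continuous_on UNIV f2"
  shows "f2 z u v = f2 z v u"
proof -
  define s where "s n = inverse (real (Suc n))" for n
  have s: "s n > 0" for n by (simp add: s_def)
  have s0: "s \<longlonglongrightarrow> 0"
    unfolding s_def by (rule LIMSEQ_inverse_real_of_nat)
  have lim: "(\<lambda>n. f2 (z + \<alpha> n *\<^sub>R p + \<beta> n *\<^sub>R q) q p) \<longlonglongrightarrow> f2 z q p"
    if "\<And>n. 0 < \<alpha> n \<and> \<alpha> n < s n \<and> 0 < \<beta> n \<and> \<beta> n < s n" for \<alpha> \<beta> p q
  proof -
    have "\<alpha> \<longlonglongrightarrow> 0" "\<beta> \<longlonglongrightarrow> 0"
      by (rule tendsto_sandwich [OF _ _ tendsto_const s0];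
        use that in \<open>auto intro!: always_eventually less_imp_le\<close>)+
    then have "(\<lambda>n. z + \<alpha> n *\<^sub>R p + \<beta> n *\<^sub>R q) \<longlonglongrightarrow> z + 0 *\<^sub>R p + 0 *\<^sub>R q"
      by (intro tendsto_intros)
    moreover have "isCont f2 z"
      using cont by (simp add: continuous_on_eq_continuous_at)
    ultimately have "(\<lambda>n. f2 (z + \<alpha> n *\<^sub>R p + \<beta> n *\<^sub>R q)) \<longlonglongrightarrow> f2 z"
      using isCont_tendsto_compose [of z f2] by simp
    then show ?thesis by (intro tendsto_intros)
  qed
  obtain \<alpha> \<beta> where 1: "\<And>n. 0 < \<alpha> n \<and> \<alpha> n < s n \<and> 0 < \<beta> n \<and> \<beta> n < s n \<and>
    f (z + s n *\<^sub>R u + s n *\<^sub>R v) - f (z + s n *\<^sub>R u) - f (z + s n *\<^sub>R v) + f z =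
      (s n)\<^sup>2 * f2 (z + \<alpha> n *\<^sub>R u + \<beta> n *\<^sub>R v) v u"
    using mixed_difference_mvt [OF f1 f2 s, where z = z and u = u and v = v] by metis
  obtain \<gamma> \<delta> where 2: "\<And>n. 0 < \<gamma> n \<and> \<gamma> n < s n \<and> 0 < \<delta> n \<and> \<delta> n < s n \<and>
    f (z + s n *\<^sub>R v + s n *\<^sub>R u) - f (z + s n *\<^sub>R v) - f (z + s n *\<^sub>R u) + f z =
      (s n)\<^sup>2 * f2 (z + \<gamma> n *\<^sub>R v + \<delta> n *\<^sub>R u) u v"
    using mixed_difference_mvt [OF f1 f2 s, where z = z and u = v and v = u] by metis
  have sq: "(s n)\<^sup>2 * f2 (z + \<alpha> n *\<^sub>R u + \<beta> n *\<^sub>R v) v u =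
      (s n)\<^sup>2 * f2 (z + \<gamma> n *\<^sub>R v + \<delta> n *\<^sub>R u) u v" for n
    using 1 [of n] 2 [of n] by (simp add: algebra_simps)
  have "f2 (z + \<alpha> n *\<^sub>R u + \<beta> n *\<^sub>R v) v u = f2 (z + \<gamma> n *\<^sub>R v + \<delta> n *\<^sub>R u) u v" for n
    using s [of n] sq [of n] by simp
  with lim [of \<alpha> \<beta> u v] lim [of \<gamma> \<delta> v u] show ?thesis
    using 1 2 LIMSEQ_unique by auto
qed

text \<open>An integral over the parameter rectangle instead of one against
  \<open>sphere_area\<close>: for continuous integrands on a compact rectangle, Fubini and
  differentiation under the integral apply directly. \<open>spherical_mean_eq\<close> makes the
  link.\<close>

definition sphere_avg :: "(real^3 \<Rightarrow> real) \<Rightarrow> real" where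
  "sphere_avg g =
     1 / (4 * pi) * integral (cbox (0, 0) (pi, 2 * pi)) (\<lambda>\<sigma>. sin (fst \<sigma>) * g (sphere_point \<sigma>))"

lemma continuous_on_sphere_point [continuous_intros]:
  fixes h :: "'a::t2_space \<Rightarrow> real \<times> real"
  shows "continuous_on S h \<Longrightarrow> continuous_on S (\<lambda>x. sphere_point (h x))"
  unfolding sphere_point_def case_prod_unfold
  by (intro continuous_on_vector_3 continuous_intros)

lemma sphere_point_nth [simp]:
  "sphere_point (\<theta>, \<phi>) $ 1 = sin \<theta> * cos \<phi>"
  "sphere_point (\<theta>, \<phi>) $ 2 = sin \<theta> * sin \<phi>"
  "sphere_point (\<theta>, \<phi>) $ 3 = cos \<theta>"
  by (simp_all add: sphere_point_def)

lemma norm_vec3: "norm (x :: real^3) = sqrt ((x $ 1)\<^sup>2 + (x $ 2)\<^sup>2 + (x $ 3)\<^sup>2)"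
  by (simp add: norm_vec_def L2_set_def sum_3)

lemma norm_sphere_point [simp]: "norm (sphere_point \<sigma>) = 1"
proof (cases \<sigma>)
  case (Pair \<theta> \<phi>)
  have "(sin \<theta> * cos \<phi>)\<^sup>2 + (sin \<theta> * sin \<phi>)\<^sup>2 + (cos \<theta>)\<^sup>2 =
      (sin \<theta>)\<^sup>2 * ((cos \<phi>)\<^sup>2 + (sin \<phi>)\<^sup>2) + (cos \<theta>)\<^sup>2"
    by (simp only: power_mult_distrib distrib_left)
  also have "\<dots> = 1"
    by (simp only: sin_cos_squared_add sin_cos_squared_add2 mult_1_right)
  finally show ?thesis using Pair by (simp add: norm_vec3)
qed

lemma sphere_avg_zero: "(\<And>\<omega>. norm \<omega> = 1 \<Longrightarrow> g \<omega> = 0) \<Longrightarrow> sphere_avg g = 0"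
  unfolding sphere_avg_def by simp

lemma continuous_on_sphere_avg:
  fixes g :: "'a::t2_space \<Rightarrow> real^3 \<Rightarrow> real"
  assumes "continuous_on (U \<times> UNIV) (\<lambda>(x, \<omega>). g x \<omega>)"
  shows "continuous_on U (\<lambda>x. sphere_avg (g x))"
  unfolding sphere_avg_def
  apply (intro continuous_intros integral_continuous_on_param)
  unfolding case_prod_unfold
  apply (intro continuous_intros continuous_on_compose2 [OF assms, of _ "\<lambda>z. (fst z, sphere_point (snd z))", simplified])
  apply auto
  done

lemma sphere_avg_integrable:
  assumes "continuous_on UNIV g"
  shows "(\<lambda>\<sigma>. sin (fst \<sigma>) * g (sphere_point \<sigma>)) integrable_on cbox (0, 0) (pi, 2 * pi)"
  by (intro integrable_continuous continuous_intros continuous_on_compose2 [OF assms]) auto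

lemma sphere_avg_linear:
  assumes "continuous_on UNIV g" "continuous_on UNIV h"
  shows "sphere_avg (\<lambda>\<omega>. c * g \<omega> + d * h \<omega>) = c * sphere_avg g + d * sphere_avg h"
proof -
  have "integral (cbox (0, 0) (pi, 2 * pi)) (\<lambda>\<sigma>. sin (fst \<sigma>) * (c * g (sphere_point \<sigma>) + d * h (sphere_point \<sigma>)))
    = integral (cbox (0, 0) (pi, 2 * pi)) (\<lambda>\<sigma>. c *\<^sub>R (sin (fst \<sigma>) * g (sphere_point \<sigma>)) + d *\<^sub>R (sin (fst \<sigma>) * h (sphere_point \<sigma>)))"
    by (simp add: algebra_simps)
  also have "\<dots> = c *\<^sub>R integral (cbox (0, 0) (pi, 2 * pi)) (\<lambda>\<sigma>. sin (fst \<sigma>) * g (sphere_point \<sigma>)) +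
      d *\<^sub>R integral (cbox (0, 0) (pi, 2 * pi)) (\<lambda>\<sigma>. sin (fst \<sigma>) * h (sphere_point \<sigma>))"
    by (subst integral_add) (auto intro!: integrable_cmul sphere_avg_integrable assms simp del: real_scaleR_def)
  finally show ?thesis
    unfolding sphere_avg_def by (simp add: algebra_simps)
qed

lemma sphere_avg_diff:
  assumes "continuous_on UNIV g" "continuous_on UNIV h"
  shows "sphere_avg (\<lambda>\<omega>. g \<omega> - h \<omega>) = sphere_avg g - sphere_avg h"
  using sphere_avg_linear [OF assms, of 1 "-1"] by simp

lemma sphere_avg_const: "sphere_avg (\<lambda>\<omega>. c) = c"
proof -
  have "integral (cbox (0, 0) (pi, 2 * pi)) (\<lambda>\<sigma>::real \<times> real. sin (fst \<sigma>) * c) =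
      integral (cbox 0 pi) (\<lambda>\<theta>. integral (cbox 0 (2 * pi)) (\<lambda>\<phi>::real. sin \<theta> * c))"
    by (subst integral_prod_continuous) (auto intro!: continuous_intros)
  also have "\<dots> = integral (cbox 0 pi) (\<lambda>\<theta>. 2 * pi * c * sin \<theta>)"
    by (simp add: mult_ac)
  also have "\<dots> = 2 * pi * c * integral {0..pi} sin"
    by simp
  also have "integral {0..pi} sin = 2"
  proof (rule integral_unique)
    have "(sin has_integral (- cos pi - (- cos 0))) {0..pi}"
      by (rule fundamental_theorem_of_calculus)
        (auto intro!: derivative_eq_intros simp flip: has_real_derivative_iff_has_vector_derivative)
    then show "(sin has_integral 2) {0..pi}" by simp
  qed
  finally have eq: "integral (cbox (0, 0) (pi, 2 * pi)) (\<lambda>\<sigma>::real \<times> real. sin (fst \<sigma>) * c) = 2 * pi * c * 2" .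
  show ?thesis unfolding sphere_avg_def eq by simp
qed

lemma has_real_derivative_sphere_avg:
  assumes d: "\<And>s \<omega>. ((\<lambda>s. g s \<omega>) has_real_derivative g' s \<omega>) (at s)"
    and c: "\<And>s. continuous_on UNIV (g s)"
    and c': "continuous_on UNIV (\<lambda>(s, \<omega>). g' s \<omega>)"
  shows "((\<lambda>s. sphere_avg (g s)) has_real_derivative sphere_avg (g' s)) (at s)"
proof -
  have "((\<lambda>s. integral (cbox (0, 0) (pi, 2 * pi)) (\<lambda>\<sigma>. sin (fst \<sigma>) * g s (sphere_point \<sigma>)))
      has_real_derivative integral (cbox (0, 0) (pi, 2 * pi)) (\<lambda>\<sigma>. sin (fst \<sigma>) * g' s (sphere_point \<sigma>)))
      (at s within UNIV)"
    apply (rule leibniz_rule_field_derivative)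
        apply (rule DERIV_cmult [OF d])
       apply (rule sphere_avg_integrable [OF c])
    unfolding case_prod_unfold
      apply (intro continuous_intros continuous_on_compose2 [OF c', of _ "\<lambda>z. (fst z, sphere_point (snd z))", simplified])
    by auto
  then show ?thesis unfolding sphere_avg_def by (rule DERIV_cmult)
qed

lemma spherical_mean_eq:
  assumes "continuous_on UNIV f"
  shows "spherical_mean f y r = sphere_avg (\<lambda>\<omega>. f (y + r *\<^sub>R \<omega>))"
proof -
  let ?D = "{0..pi} \<times> {0..2 * pi}"
  have [measurable]: "f \<in> borel_measurable borel"
    by (rule borel_measurable_continuous_onI [OF assms])
  \<comment> \<open>The density passes through \<open>ennreal\<close>, which cuts off negative
    values; on the parameter rectangle \<open>sin\<close> is nonnegative, so nothing is
    lost.\<close>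
  have nn: "0 \<le> indicator ?D (\<theta>, \<phi>) * sin \<theta>" for \<theta> \<phi> :: real
    by (auto simp: indicator_def sin_ge_zero)
  have m: "(\<lambda>\<sigma>. indicator ?D \<sigma> * sin (fst \<sigma>)) \<in> borel_measurable borel"
    by (intro borel_measurable_times borel_measurable_indicator borel_measurable_continuous_onI
        continuous_intros) (intro borel_closed closed_Times closed_atLeastAtMost)
  have "(LINT \<omega>|sphere_area. f (y + r *\<^sub>R \<omega>)) =
      (LINT \<sigma>|density lborel (\<lambda>(\<theta>, \<phi>). ennreal (indicator ?D (\<theta>, \<phi>) * sin \<theta>)). f (y + r *\<^sub>R sphere_point \<sigma>))"
    unfolding sphere_area_def by (subst integral_distr) auto
  also have "\<dots> = (LINT \<sigma>|lborel. (indicator ?D \<sigma> * sin (fst \<sigma>)) *\<^sub>R f (y + r *\<^sub>R sphere_point \<sigma>))"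
    unfolding case_prod_unfold
    by (subst integral_density) (use m nn in \<open>auto simp: case_prod_unfold\<close>)
  also have "\<dots> = (LINT \<sigma>:?D|lborel. sin (fst \<sigma>) * f (y + r *\<^sub>R sphere_point \<sigma>))"
    by (simp add: set_lebesgue_integral_def mult.assoc)
  also have "?D = cbox (0, 0) (pi, 2 * pi)" by (simp add: cbox_Pair_eq)
  also have "(LINT \<sigma>:\<dots>|lborel. sin (fst \<sigma>) * f (y + r *\<^sub>R sphere_point \<sigma>)) =
     integral (cbox (0, 0) (pi, 2 * pi)) (\<lambda>\<sigma>. sin (fst \<sigma>) * f (y + r *\<^sub>R sphere_point \<sigma>))"
    unfolding set_integrable_def[symmetric]
    by (intro set_borel_integral_eq_integral(2))
       (unfold set_integrable_def, intro borel_integrable_compact continuous_intros continuous_on_compose2 [OF assms], auto)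
  finally show ?thesis by (simp add: spherical_mean_def sphere_avg_def)
qed

section \<open>The wave generated by a function\<close>

text \<open>Derivatives on the whole space, since spheres around points of the closed cube reach
  beyond it; \<open>C2_compact_support_extend\<close> supplies them.\<close>

locale c2_function =
  fixes f :: "real^3 \<Rightarrow> real"
    and f1 :: "real^3 \<Rightarrow> ((real^3) \<Rightarrow>\<^sub>L real)"
    and f2 :: "real^3 \<Rightarrow> ((real^3) \<Rightarrow>\<^sub>L (real^3) \<Rightarrow>\<^sub>L real)"
  assumes f1: "(f has_derivative blinfun_apply (f1 x)) (at x)"
    and f2: "(f1 has_derivative blinfun_apply (f2 x)) (at x)"
    and cont_f2: "continuous_on UNIV f2"
begin

lemma f2_commute: "f2 z u v = f2 z v u"
  by (rule second_derivative_symmetric [OF f1 f2 cont_f2])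

lemma cont_f: "continuous_on UNIV f"
  by (simp add: continuous_on_eq_continuous_at has_derivative_continuous [OF f1])

lemma cont_f1: "continuous_on UNIV f1"
  by (simp add: continuous_on_eq_continuous_at has_derivative_continuous [OF f2])

lemma cont [continuous_intros]:
  assumes "continuous_on S g"
  shows "continuous_on S (\<lambda>x. f (g x))" "continuous_on S (\<lambda>x. f1 (g x))"
    "continuous_on S (\<lambda>x. f2 (g x))"
  using continuous_on_compose2 [OF cont_f assms] continuous_on_compose2 [OF cont_f1 assms]
    continuous_on_compose2 [OF cont_f2 assms] by auto

lemma deriv_f:
  assumes "(c has_vector_derivative c') (at s)"
  shows "((\<lambda>s. f (c s)) has_real_derivative f1 (c s) c') (at s)"
  using has_derivative_compose [OF assms [unfolded has_vector_derivative_def] f1]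
  by (simp add: has_field_derivative_def blinfun.scaleR_right mult_commute_abs)

lemma deriv_f1:
  assumes "(c has_vector_derivative c') (at s)" "(w has_vector_derivative w') (at s)"
  shows "((\<lambda>s. f1 (c s) (w s)) has_real_derivative f2 (c s) c' (w s) + f1 (c s) w') (at s)"
proof -
  have "((\<lambda>s. f1 (c s)) has_vector_derivative f2 (c s) c') (at s)"
    using has_derivative_compose [OF assms(1) [unfolded has_vector_derivative_def] f2]
    by (simp add: has_vector_derivative_def blinfun.scaleR_right)
  from bounded_bilinear.has_vector_derivative [OF bounded_bilinear_blinfun_apply this assms(2)]
  show ?thesis by (simp add: has_real_derivative_iff_has_vector_derivative add.commute)
qed

text \<open>\<open>V0\<close> is the wave u = t M. The digit counts time derivatives and each
  \<open>d\<close> is a derivative in the direction \<open>e\<close>, all taken inside the average: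
  \<open>V1d e\<close> is the mixed one, \<open>V0dd e\<close> the second one in space.\<close>

definition V0 :: "real^3 \<Rightarrow> real \<Rightarrow> real" where
  "V0 y t = sphere_avg (\<lambda>\<omega>. t * f (y + t *\<^sub>R \<omega>))"

definition V1 :: "real^3 \<Rightarrow> real \<Rightarrow> real" where
  "V1 y t = sphere_avg (\<lambda>\<omega>. f (y + t *\<^sub>R \<omega>) + t * f1 (y + t *\<^sub>R \<omega>) \<omega>)"

definition V2 :: "real^3 \<Rightarrow> real \<Rightarrow> real" where
  "V2 y t = sphere_avg (\<lambda>\<omega>. 2 * f1 (y + t *\<^sub>R \<omega>) \<omega> + t * f2 (y + t *\<^sub>R \<omega>) \<omega> \<omega>)"

definition V0d :: "real^3 \<Rightarrow> real^3 \<Rightarrow> real \<Rightarrow> real" where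
  "V0d e y t = sphere_avg (\<lambda>\<omega>. t * f1 (y + t *\<^sub>R \<omega>) e)"

definition V1d :: "real^3 \<Rightarrow> real^3 \<Rightarrow> real \<Rightarrow> real" where
  "V1d e y t = sphere_avg (\<lambda>\<omega>. f1 (y + t *\<^sub>R \<omega>) e + t * f2 (y + t *\<^sub>R \<omega>) e \<omega>)"

definition V0dd :: "real^3 \<Rightarrow> real^3 \<Rightarrow> real \<Rightarrow> real" where
  "V0dd e y t = sphere_avg (\<lambda>\<omega>. t * f2 (y + t *\<^sub>R \<omega>) e e)"

lemma cont_V [continuous_intros]:
  fixes y :: "'a::t2_space \<Rightarrow> real^3"
  assumes "continuous_on S y" "continuous_on S t"
  shows "continuous_on S (\<lambda>x. V0 (y x) (t x))" "continuous_on S (\<lambda>x. V1 (y x) (t x))"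
    "continuous_on S (\<lambda>x. V2 (y x) (t x))" "continuous_on S (\<lambda>x. V0d e (y x) (t x))"
    "continuous_on S (\<lambda>x. V1d e (y x) (t x))" "continuous_on S (\<lambda>x. V0dd e (y x) (t x))"
proof -
  have [continuous_intros]: "continuous_on (S \<times> UNIV) (\<lambda>z. y (fst z))" "continuous_on (S \<times> UNIV) (\<lambda>z. t (fst z))"
    using assms by (auto intro!: continuous_on_compose2 [OF _ continuous_on_fst])
  show "continuous_on S (\<lambda>x. V0 (y x) (t x))" "continuous_on S (\<lambda>x. V1 (y x) (t x))"
    "continuous_on S (\<lambda>x. V2 (y x) (t x))" "continuous_on S (\<lambda>x. V0d e (y x) (t x))"
    "continuous_on S (\<lambda>x. V1d e (y x) (t x))" "continuous_on S (\<lambda>x. V0dd e (y x) (t x))"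
    unfolding V0_def V1_def V2_def V0d_def V1d_def V0dd_def
    by (intro continuous_on_sphere_avg; unfold case_prod_unfold; intro continuous_intros)+
qed

text \<open>The Kirchhoff field evaluates the wave at the time \<tau> + r, which changes with the
  point. Hence derivatives are taken along a line with centre and time moving together;
  \<open>e = 0\<close> recovers plain time derivatives.\<close>

context
  fixes y e :: "real^3" and t t' :: "real \<Rightarrow> real"
  assumes t: "\<And>s. (t has_real_derivative t' s) (at s)"
    and t': "continuous_on UNIV t'"
begin

lemma cont_t: "continuous_on UNIV t"
  using t by (auto simp: continuous_on_eq_continuous_at intro: DERIV_isCont)

lemma cont_pair_t [continuous_intros]:
  "continuous_on UNIV (\<lambda>z :: real \<times> (real^3). t (fst z))"
  "continuous_on UNIV (\<lambda>z :: real \<times> (real^3). t' (fst z))"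
  by (auto intro!: continuous_on_compose2 [OF _ continuous_on_fst] cont_t t')

lemma deriv_moving:
  "((\<lambda>s. y + s *\<^sub>R e + t s *\<^sub>R \<omega>) has_vector_derivative e + t' s *\<^sub>R \<omega>) (at s)"
  by (auto intro!: derivative_eq_intros t)

lemma deriv_V0:
  "((\<lambda>s. V0 (y + s *\<^sub>R e) (t s)) has_real_derivative
     V0d e (y + s *\<^sub>R e) (t s) + t' s * V1 (y + s *\<^sub>R e) (t s)) (at s)"
proof -
  have "((\<lambda>s. V0 (y + s *\<^sub>R e) (t s)) has_real_derivative
      sphere_avg (\<lambda>\<omega>. 1 * (t s * f1 (y + s *\<^sub>R e + t s *\<^sub>R \<omega>) e) + t' s * (f (y + s *\<^sub>R e + t s *\<^sub>R \<omega>)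
        + t s * f1 (y + s *\<^sub>R e + t s *\<^sub>R \<omega>) \<omega>))) (at s)"
    unfolding V0_def
    apply (rule has_real_derivative_sphere_avg)
      apply (rule DERIV_mult' [OF t deriv_f [OF deriv_moving], THEN DERIV_cong])
      apply (simp add: blinfun.add_right blinfun.scaleR_right algebra_simps)
     apply (intro continuous_intros)
    unfolding case_prod_unfold by (intro continuous_intros)
  then show ?thesis unfolding V0d_def V1_def
    by (subst (asm) sphere_avg_linear) (auto intro!: continuous_intros)
qed

lemma deriv_V1:
  "((\<lambda>s. V1 (y + s *\<^sub>R e) (t s)) has_real_derivative
     V1d e (y + s *\<^sub>R e) (t s) + t' s * V2 (y + s *\<^sub>R e) (t s)) (at s)"
proof -
  have "((\<lambda>s. V1 (y + s *\<^sub>R e) (t s)) has_real_derivative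
      sphere_avg (\<lambda>\<omega>. 1 * (f1 (y + s *\<^sub>R e + t s *\<^sub>R \<omega>) e + t s * f2 (y + s *\<^sub>R e + t s *\<^sub>R \<omega>) e \<omega>)
        + t' s * (2 * f1 (y + s *\<^sub>R e + t s *\<^sub>R \<omega>) \<omega> + t s * f2 (y + s *\<^sub>R e + t s *\<^sub>R \<omega>) \<omega> \<omega>))) (at s)"
    unfolding V1_def
    apply (rule has_real_derivative_sphere_avg)
      apply (rule DERIV_add [OF deriv_f [OF deriv_moving]
        DERIV_mult' [OF t deriv_f1 [OF deriv_moving has_vector_derivative_const]], THEN DERIV_cong])
      apply (simp add: blinfun.add_right blinfun.scaleR_right blinfun.add_left blinfun.scaleR_left
        blinfun.zero_right algebra_simps)
     apply (intro continuous_intros)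
    unfolding case_prod_unfold by (intro continuous_intros)
  then show ?thesis unfolding V1d_def V2_def
    by (subst (asm) sphere_avg_linear) (auto intro!: continuous_intros)
qed

lemma deriv_V0d:
  "((\<lambda>s. V0d e (y + s *\<^sub>R e) (t s)) has_real_derivative
     V0dd e (y + s *\<^sub>R e) (t s) + t' s * V1d e (y + s *\<^sub>R e) (t s)) (at s)"
proof -
  have "((\<lambda>s. V0d e (y + s *\<^sub>R e) (t s)) has_real_derivative
      sphere_avg (\<lambda>\<omega>. 1 * (t s * f2 (y + s *\<^sub>R e + t s *\<^sub>R \<omega>) e e)
        + t' s * (f1 (y + s *\<^sub>R e + t s *\<^sub>R \<omega>) e + t s * f2 (y + s *\<^sub>R e + t s *\<^sub>R \<omega>) e \<omega>))) (at s)"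
    unfolding V0d_def
    apply (rule has_real_derivative_sphere_avg)
      \<comment> \<open>Moving the time differentiates \<open>f1\<close> in direction \<omega> and
        then evaluates at \<open>e\<close>, whereas \<open>V1d\<close> has the opposite order; here
        the symmetry of \<open>f2\<close> enters.\<close>
      subgoal for s \<omega>
        by (rule DERIV_mult' [OF t deriv_f1 [OF deriv_moving has_vector_derivative_const], THEN DERIV_cong])
          (simp add: blinfun.add_right blinfun.scaleR_right blinfun.add_left blinfun.scaleR_left
            blinfun.zero_right algebra_simps f2_commute [of _ e \<omega>])
     apply (intro continuous_intros)
    unfolding case_prod_unfold by (intro continuous_intros)
  then show ?thesis unfolding V0dd_def V1d_def
    by (subst (asm) sphere_avg_linear) (auto intro!: continuous_intros)
qed

end

lemma V0d_0 [simp]: "V0d 0 y t = 0" "V1d 0 y t = 0"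
  by (simp_all add: V0d_def V1d_def sphere_avg_const blinfun.zero_left blinfun.zero_right)

lemma V0_deriv: "(V0 y has_real_derivative V1 y t) (at t)"
  using deriv_V0 [where t = "\<lambda>s. s" and t' = "\<lambda>_. 1" and e = 0 and y = y and s = t] by simp

lemma V1_deriv: "(V1 y has_real_derivative V2 y t) (at t)"
  using deriv_V1 [where t = "\<lambda>s. s" and t' = "\<lambda>_. 1" and e = 0 and y = y and s = t] by simp

lemma V0_eq: "V0 y t = t * spherical_mean f y t"
  unfolding spherical_mean_eq [OF cont_f] V0_def
  using sphere_avg_linear [of "\<lambda>\<omega>. f (y + t *\<^sub>R \<omega>)" "\<lambda>_. 0" t 0]
  by (simp add: continuous_intros)

lemma V1_0: "V1 y 0 = f y"
  by (simp add: V1_def sphere_avg_const)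

end

section \<open>The divergence theorem on a box\<close>

lemma integral_partial_fst:
  fixes F F' :: "real \<Rightarrow> 'b::euclidean_space \<Rightarrow> real"
  assumes "\<And>x y. ((\<lambda>x. F x y) has_real_derivative F' x y) (at x)"
    and c: "continuous_on UNIV (\<lambda>(x, y). F' x y)" and "a \<le> b"
  shows "integral (cbox (a, c) (b, d)) (\<lambda>(x, y). F' x y) = integral (cbox c d) (\<lambda>y. F b y - F a y)"
proof -
  have "integral (cbox (a, c) (b, d)) (\<lambda>(x, y). F' x y) =
      integral (cbox a b) (\<lambda>x. integral (cbox c d) (F' x))"
    by (subst integral_prod_continuous) (auto intro: continuous_on_subset [OF c])
  also have "\<dots> = integral (cbox c d) (\<lambda>y. integral (cbox a b) (\<lambda>x. F' x y))"
    by (rule integral_swap_continuous) (rule continuous_on_subset [OF c], simp)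
  also have "(\<lambda>y. integral (cbox a b) (\<lambda>x. F' x y)) = (\<lambda>y. F b y - F a y)"
    unfolding cbox_interval
    by (intro ext integral_unique fundamental_theorem_of_calculus \<open>a \<le> b\<close>)
      (auto intro: has_field_derivative_at_within assms(1)
        simp flip: has_real_derivative_iff_has_vector_derivative)
  finally show ?thesis .
qed

lemma integral_partial_snd:
  fixes F F' :: "real \<Rightarrow> 'b::euclidean_space \<Rightarrow> real"
  assumes "\<And>x y. ((\<lambda>x. F x y) has_real_derivative F' x y) (at x)"
    and c: "continuous_on UNIV (\<lambda>(x, y). F' x y)" and "a \<le> b"
  shows "integral (cbox (c, a) (d, b)) (\<lambda>(y, x). F' x y) = integral (cbox c d) (\<lambda>y. F b y - F a y)"
proof -
  have "integral (cbox (c, a) (d, b)) (\<lambda>(y, x). F' x y) = integral (cbox (a, c) (b, d)) (\<lambda>(x, y). F' x y)"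
    by (rule integral_swap_2dim [symmetric]) (rule continuous_on_subset [OF c], simp)
  also have "\<dots> = integral (cbox c d) (\<lambda>y. F b y - F a y)"
    by (rule integral_partial_fst [OF assms])
  finally show ?thesis .
qed

definition box_integral :: "real \<Rightarrow> (real^3 \<Rightarrow> real) \<Rightarrow> real" where
  "box_integral a g = integral (cbox (- a, - a, - a) (a, a, a)) (\<lambda>(u, v, w). g (vector [u, v, w]))"

definition face_integral :: "real \<Rightarrow> (real \<times> real \<Rightarrow> real) \<Rightarrow> real" where
  "face_integral a g = integral (cbox (- a, - a) (a, a)) g"

lemma plane_point_add: "plane_point i (c + s) \<eta> = plane_point i c \<eta> + s *\<^sub>R axis i 1"
  using exhaust_3 [of i] by (cases \<eta>) (auto simp: plane_point_def vec_eq_iff forall_3 axis_def)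

lemma continuous_on_plane_point [continuous_intros]:
  assumes "continuous_on S c" "continuous_on S \<eta>"
  shows "continuous_on S (\<lambda>x. plane_point i (c x) (\<eta> x))"
  unfolding plane_point_def case_prod_unfold
  by (cases "i = 1"; cases "i = 2") (auto intro!: continuous_on_vector_3 continuous_intros assms)

text \<open>The divergence theorem for a field with a single component: the fundamental theorem of
  calculus on lines parallel to axis \<open>i\<close>, once Fubini has made that variable the
  innermost one.\<close>

lemma box_integral_partial:
  assumes d: "\<And>y. ((\<lambda>s. G (y + s *\<^sub>R axis i 1)) has_real_derivative G' y) (at 0)"
    and c: "continuous_on UNIV G'" and a: "a \<ge> 0"
  shows "box_integral a G' =
    face_integral a (\<lambda>\<eta>. G (plane_point i a \<eta>) - G (plane_point i (- a) \<eta>))"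
proof -
  note [continuous_intros] = continuous_on_compose2 [OF c _ subset_UNIV]
  have dd: "((\<lambda>s. G (plane_point i s \<eta>)) has_real_derivative G' (plane_point i c \<eta>)) (at c)" for c \<eta>
  proof -
    have "((\<lambda>s. G (plane_point i (s + c) \<eta>)) has_real_derivative G' (plane_point i c \<eta>)) (at 0)"
      using d [of "plane_point i c \<eta>"] by (simp add: plane_point_add [symmetric] add.commute)
    then show ?thesis using DERIV_shift [of "\<lambda>s. G (plane_point i s \<eta>)" _ 0 c] by simp
  qed
  have ftc: "integral (cbox (-a) a) (\<lambda>s. G' (plane_point i s \<eta>)) =
      G (plane_point i a \<eta>) - G (plane_point i (- a) \<eta>)" for \<eta>
    unfolding cbox_interval
    by (intro integral_unique fundamental_theorem_of_calculus)
      (use a in \<open>auto intro: has_field_derivative_at_within dd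
        simp flip: has_real_derivative_iff_has_vector_derivative\<close>)
  have cI: "continuous_on UNIV (\<lambda>\<eta>. integral (cbox (- a) a) (\<lambda>s. G' (plane_point i s \<eta>)))"
    by (intro integral_continuous_on_param) (auto simp: case_prod_unfold intro!: continuous_intros)
  have "box_integral a G' = face_integral a (\<lambda>\<eta>. integral (cbox (- a) a) (\<lambda>s. G' (plane_point i s \<eta>)))"
  proof -
    \<comment> \<open>The parametrization nests the coordinates in the order 1, 2, 3: the third is
      innermost already, the second needs one swap, the first is swapped past the remaining
      pair.\<close>
    consider "i = 1" | "i = 2" | "i = 3" using exhaust_3 by blast
    then show ?thesis
    proof cases
      case 1
      then have "box_integral a G' = integral (cbox (- a, - a, - a) (a, a, a)) (\<lambda>(u, \<eta>). G' (plane_point i u \<eta>))"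
        by (simp add: box_integral_def plane_point_def case_prod_unfold)
      also have "\<dots> = integral (cbox (- a) a) (\<lambda>u. integral (cbox (- a, - a) (a, a)) (\<lambda>\<eta>. G' (plane_point i u \<eta>)))"
        by (subst integral_prod_continuous) (auto simp: case_prod_unfold intro!: continuous_intros)
      finally show ?thesis
        unfolding face_integral_def
        by (subst integral_swap_continuous) (auto simp: case_prod_unfold intro!: continuous_intros)
    next
      case 2
      then have "box_integral a G' = integral (cbox (- a, - a, - a) (a, a, a))
          (\<lambda>z. G' (plane_point i (fst (snd z)) (fst z, snd (snd z))))"
        by (simp add: box_integral_def plane_point_def case_prod_unfold)
      also have "\<dots> = integral (cbox (-a) a) (\<lambda>u. integral (cbox (- a, - a) (a, a))
          (\<lambda>z. G' (plane_point i (fst z) (u, snd z))))"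
        by (subst integral_prod_continuous) (auto intro!: continuous_intros)
      also have "\<dots> = integral (cbox (-a) a) (\<lambda>u. integral (cbox (-a) a)
          (\<lambda>v. integral (cbox (-a) a) (\<lambda>w. G' (plane_point i v (u, w)))))"
        by (subst integral_prod_continuous) (auto intro!: continuous_intros)
      also have "\<dots> = integral (cbox (-a) a) (\<lambda>u. integral (cbox (-a) a)
          (\<lambda>w. integral (cbox (-a) a) (\<lambda>v. G' (plane_point i v (u, w)))))"
        by (subst integral_swap_continuous) (auto simp: case_prod_unfold intro!: continuous_intros)
      finally show ?thesis
        using integral_prod_continuous [OF continuous_on_subset [OF cI subset_UNIV], of "- a" "- a" a a]
        by (simp add: face_integral_def)
    next
      case 3
      then have "box_integral a G' = integral (cbox (- a, - a, - a) (a, a, a))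
          (\<lambda>z. G' (plane_point i (snd (snd z)) (fst z, fst (snd z))))"
        by (simp add: box_integral_def plane_point_def case_prod_unfold)
      also have "\<dots> = integral (cbox (-a) a) (\<lambda>u. integral (cbox (- a, - a) (a, a))
          (\<lambda>z. G' (plane_point i (snd z) (u, fst z))))"
        by (subst integral_prod_continuous) (auto intro!: continuous_intros)
      also have "\<dots> = integral (cbox (-a) a) (\<lambda>u. integral (cbox (-a) a)
          (\<lambda>v. integral (cbox (- a) a) (\<lambda>w. G' (plane_point i w (u, v)))))"
        by (subst integral_prod_continuous) (auto intro!: continuous_intros)
      finally show ?thesis
        using integral_prod_continuous [OF continuous_on_subset [OF cI subset_UNIV], of "- a" "- a" a a]
        by (simp add: face_integral_def)
    qed
  qed
  then show ?thesis by (simp only: ftc)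
qed

lemma quadratic_axis_expansion:
  fixes B :: "(real^3) \<Rightarrow>\<^sub>L (real^3) \<Rightarrow>\<^sub>L real"
  shows "B u u = (\<Sum>i\<in>UNIV. \<Sum>j\<in>UNIV. u $ i * u $ j * B (axis i 1) (axis j 1))"
proof -
  have "u = (\<Sum>i\<in>UNIV. u $ i *\<^sub>R axis i 1)"
    using basis_expansion [of u] by (simp add: scalar_mult_eq_scaleR)
  then have "B u u = B (\<Sum>i\<in>UNIV. u $ i *\<^sub>R axis i 1) (\<Sum>j\<in>UNIV. u $ j *\<^sub>R axis j 1)"
    by simp
  then show ?thesis
    by (simp add: sum_3 blinfun.add_left blinfun.add_right blinfun.scaleR_left blinfun.scaleR_right
        algebra_simps)
qed

text \<open>A trace is the same in every orthonormal basis. The matrix with rows \<omega>, \<alpha>,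
  \<beta> is orthogonal, so its columns are orthonormal too; that is \<open>orth\<close>.\<close>

lemma trace_spherical_frame:
  fixes B :: "(real^3) \<Rightarrow>\<^sub>L (real^3) \<Rightarrow>\<^sub>L real" and \<theta> \<phi> :: real
  defines "\<omega> \<equiv> sphere_point (\<theta>, \<phi>)"
    and "\<alpha> \<equiv> vector [cos \<theta> * cos \<phi>, cos \<theta> * sin \<phi>, - sin \<theta>]"
    and "\<beta> \<equiv> vector [- sin \<phi>, cos \<phi>, 0]"
  shows "B \<omega> \<omega> + B \<alpha> \<alpha> + B \<beta> \<beta> = (\<Sum>i\<in>UNIV. B (axis i 1) (axis i 1))"
proof -
  have sc: "sin x * sin x = 1 - cos x * cos x" for x :: real
    using sin_cos_squared_add [of x] by (simp add: power2_eq_square)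
  have sc': "sin x * (sin x * y) = y - cos x * (cos x * y)" for x y :: real
    using sc [of x] by (simp add: mult.assoc [symmetric] left_diff_distrib)
  have orth: "\<omega> $ i * \<omega> $ j + \<alpha> $ i * \<alpha> $ j + \<beta> $ i * \<beta> $ j = (if i = j then 1 else 0)" for i j
    using exhaust_3 [of i] exhaust_3 [of j] unfolding \<omega>_def \<alpha>_def \<beta>_def
    by (elim disjE) (simp_all add: algebra_simps sc sc')
  have "(\<Sum>i\<in>UNIV. B (axis i 1) (axis i 1)) = (\<Sum>i\<in>UNIV. \<Sum>j\<in>UNIV.
      (\<omega> $ i * \<omega> $ j + \<alpha> $ i * \<alpha> $ j + \<beta> $ i * \<beta> $ j) * B (axis i 1) (axis j 1))"
    unfolding orth by (simp add: if_distrib if_distribR cong: if_cong)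
  also have "\<dots> = B \<omega> \<omega> + B \<alpha> \<alpha> + B \<beta> \<beta>"
    by (simp add: quadratic_axis_expansion [of B \<omega>] quadratic_axis_expansion [of B \<alpha>]
        quadratic_axis_expansion [of B \<beta>] distrib_right sum.distrib)
  finally show ?thesis ..
qed

section \<open>The wave equation and the Kirchhoff field\<close>

context c2_function
begin

text \<open>In spherical coordinates, \<open>sin \<theta>\<close> times the difference of the two integrands is the
  divergence of \<open>(sin \<theta> * f1 z \<alpha>, f1 z \<beta>)\<close>, where \<open>\<alpha>, \<beta>\<close> are the unit tangent vectors;
  its first component vanishes at the poles and the second one is periodic.\<close>

lemma wave_equation: "(\<Sum>i\<in>UNIV. V0dd (axis i 1) y t) = V2 y t"
proof -
  define \<alpha> :: "real \<Rightarrow> real \<Rightarrow> real^3"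
    where "\<alpha> \<theta> \<phi> = vector [cos \<theta> * cos \<phi>, cos \<theta> * sin \<phi>, - sin \<theta>]" for \<theta> \<phi>
  define \<beta> :: "real \<Rightarrow> real^3" where "\<beta> \<phi> = vector [- sin \<phi>, cos \<phi>, 0]" for \<phi>
  define \<beta>' :: "real \<Rightarrow> real^3" where "\<beta>' \<phi> = vector [- cos \<phi>, - sin \<phi>, 0]" for \<phi>
  define z where "z \<theta> \<phi> = y + t *\<^sub>R sphere_point (\<theta>, \<phi>)" for \<theta> \<phi>
  have vd: "((\<lambda>s. vector [g1 s, g2 s, g3 s] :: real^3) has_vector_derivative vector [d1, d2, d3]) (at s)"
    if "(g1 has_real_derivative d1) (at s)" "(g2 has_real_derivative d2) (at s)"
      "(g3 has_real_derivative d3) (at s)" for g1 g2 g3 d1 d2 d3 s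
  proof -
    have eq: "vector [p, q, r] = p *\<^sub>R axis 1 1 + q *\<^sub>R axis 2 1 + r *\<^sub>R (axis 3 1 :: real^3)" for p q r
      by (simp add: vec_eq_iff forall_3 axis_def)
    show ?thesis unfolding eq by (auto intro!: derivative_eq_intros that)
  qed
  have w\<theta>: "((\<lambda>\<theta>. sphere_point (\<theta>, \<phi>)) has_vector_derivative \<alpha> \<theta> \<phi>) (at \<theta>)" for \<theta> \<phi>
    unfolding sphere_point_def \<alpha>_def split_conv by (intro vd) (auto intro!: derivative_eq_intros)
  have w\<phi>: "((\<lambda>\<phi>. sphere_point (\<theta>, \<phi>)) has_vector_derivative sin \<theta> *\<^sub>R \<beta> \<phi>) (at \<phi>)" for \<theta> \<phi>
  proof -
    have "sin \<theta> *\<^sub>R \<beta> \<phi> = vector [- sin \<theta> * sin \<phi>, sin \<theta> * cos \<phi>, 0]"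
      by (simp add: \<beta>_def vec_eq_iff forall_3)
    then show ?thesis
      unfolding sphere_point_def split_conv by (auto intro!: vd derivative_eq_intros)
  qed
  have \<alpha>: "((\<lambda>\<theta>. \<alpha> \<theta> \<phi>) has_vector_derivative - sphere_point (\<theta>, \<phi>)) (at \<theta>)" for \<theta> \<phi>
  proof -
    have "- sphere_point (\<theta>, \<phi>) = vector [- sin \<theta> * cos \<phi>, - sin \<theta> * sin \<phi>, - cos \<theta>]"
      by (simp add: vec_eq_iff forall_3)
    then show ?thesis unfolding \<alpha>_def by (auto intro!: vd derivative_eq_intros)
  qed
  have \<beta>: "(\<beta> has_vector_derivative \<beta>' \<phi>) (at \<phi>)" for \<phi>
    unfolding \<beta>_def [abs_def] \<beta>'_def by (intro vd) (auto intro!: derivative_eq_intros)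
  have z\<theta>: "((\<lambda>\<theta>. z \<theta> \<phi>) has_vector_derivative t *\<^sub>R \<alpha> \<theta> \<phi>) (at \<theta>)" for \<theta> \<phi>
    unfolding z_def by (auto intro!: derivative_eq_intros w\<theta>)
  have z\<phi>: "((\<lambda>\<phi>. z \<theta> \<phi>) has_vector_derivative (t * sin \<theta>) *\<^sub>R \<beta> \<phi>) (at \<phi>)" for \<theta> \<phi>
    unfolding z_def by (auto intro!: derivative_eq_intros w\<phi>)
  define A' where "A' \<theta> \<phi> = cos \<theta> * f1 (z \<theta> \<phi>) (\<alpha> \<theta> \<phi>) + sin \<theta> *
      (f2 (z \<theta> \<phi>) (t *\<^sub>R \<alpha> \<theta> \<phi>) (\<alpha> \<theta> \<phi>) + f1 (z \<theta> \<phi>) (- sphere_point (\<theta>, \<phi>)))" for \<theta> \<phi>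
  define B' where "B' \<theta> \<phi> = f2 (z \<theta> \<phi>) ((t * sin \<theta>) *\<^sub>R \<beta> \<phi>) (\<beta> \<phi>) + f1 (z \<theta> \<phi>) (\<beta>' \<phi>)" for \<theta> \<phi>
  have A: "((\<lambda>\<theta>. sin \<theta> * f1 (z \<theta> \<phi>) (\<alpha> \<theta> \<phi>)) has_real_derivative A' \<theta> \<phi>) (at \<theta>)" for \<theta> \<phi>
    unfolding A'_def by (rule DERIV_cong [OF DERIV_mult' [OF DERIV_sin deriv_f1 [OF z\<theta> \<alpha>]]]) simp
  have B: "((\<lambda>\<phi>. f1 (z \<theta> \<phi>) (\<beta> \<phi>)) has_real_derivative B' \<theta> \<phi>) (at \<phi>)" for \<theta> \<phi>
    unfolding B'_def by (rule deriv_f1 [OF z\<phi> \<beta>])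
  have [continuous_intros]: "continuous_on S (\<lambda>x. \<beta> (h x))" "continuous_on S (\<lambda>x. \<beta>' (h x))"
    if "continuous_on S h" for S :: "(real \<times> real) set" and h
    unfolding \<beta>_def \<beta>'_def by (intro continuous_intros continuous_on_vector_3 that)+
  have [continuous_intros]: "continuous_on S (\<lambda>x. z (g x) (h x))" "continuous_on S (\<lambda>x. \<alpha> (g x) (h x))"
    if "continuous_on S g" "continuous_on S h" for S :: "(real \<times> real) set" and g h
    unfolding z_def \<alpha>_def by (intro continuous_intros continuous_on_vector_3 that)+
  have cA: "continuous_on UNIV (\<lambda>(\<theta>, \<phi>). A' \<theta> \<phi>)" and cB: "continuous_on UNIV (\<lambda>(\<theta>, \<phi>). B' \<theta> \<phi>)"
    unfolding A'_def B'_def case_prod_unfold by (intro continuous_intros)+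
  have IA: "integral (cbox (0, 0) (pi, 2 * pi)) (\<lambda>(\<theta>, \<phi>). A' \<theta> \<phi>) = 0"
    by (subst integral_partial_fst [OF A cA]) auto
  have IB: "integral (cbox (0, 0) (pi, 2 * pi)) (\<lambda>(\<theta>, \<phi>). B' \<theta> \<phi>) = 0"
  proof (subst integral_partial_snd [OF B])
    show "continuous_on UNIV (\<lambda>(\<phi>, \<theta>). B' \<theta> \<phi>)"
      unfolding B'_def case_prod_unfold by (intro continuous_intros)
    have "sphere_point (\<theta>, 2 * pi) = sphere_point (\<theta>, 0)" for \<theta>
      by (simp add: sphere_point_def)
    then show "integral (cbox 0 pi) (\<lambda>\<theta>. f1 (z \<theta> (2 * pi)) (\<beta> (2 * pi)) - f1 (z \<theta> 0) (\<beta> 0)) = 0"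
      by (simp add: z_def \<beta>_def)
  qed auto
  have eq: "A' \<theta> \<phi> + B' \<theta> \<phi> = sin \<theta> * (t * (\<Sum>i\<in>UNIV. f2 (z \<theta> \<phi>) (axis i 1) (axis i 1))
      - (2 * f1 (z \<theta> \<phi>) (sphere_point (\<theta>, \<phi>))
         + t * f2 (z \<theta> \<phi>) (sphere_point (\<theta>, \<phi>)) (sphere_point (\<theta>, \<phi>))))" for \<theta> \<phi>
  proof -
    have sc: "sin \<theta> * sin \<theta> = 1 - cos \<theta> * cos \<theta>"
      using sin_cos_squared_add [of \<theta>] by (simp add: power2_eq_square)
    then have sc': "sin \<theta> * (sin \<theta> * u) = u - cos \<theta> * (cos \<theta> * u)" for u
      by (simp add: mult.assoc [symmetric] left_diff_distrib)
    \<comment> \<open>The tangential first-order terms combine into a multiple of the radial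
      direction. This is one of the two copies of the radial derivative in \<open>V2\<close>; the
      other comes from the \<theta>-derivative of \<alpha>.\<close>
    have "cos \<theta> *\<^sub>R \<alpha> \<theta> \<phi> + \<beta>' \<phi> = - sin \<theta> *\<^sub>R sphere_point (\<theta>, \<phi>)"
      by (simp add: \<alpha>_def \<beta>'_def vec_eq_iff forall_3 algebra_simps sc sc')
    then have "f1 (z \<theta> \<phi>) (cos \<theta> *\<^sub>R \<alpha> \<theta> \<phi> + \<beta>' \<phi>) = f1 (z \<theta> \<phi>) (- sin \<theta> *\<^sub>R sphere_point (\<theta>, \<phi>))"
      by simp
    then have fb: "f1 (z \<theta> \<phi>) (\<beta>' \<phi>) =
        - sin \<theta> * f1 (z \<theta> \<phi>) (sphere_point (\<theta>, \<phi>)) - cos \<theta> * f1 (z \<theta> \<phi>) (\<alpha> \<theta> \<phi>)"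
      by (simp add: blinfun.add_right blinfun.scaleR_right blinfun.minus_right)
    have tr: "(\<Sum>i\<in>UNIV. f2 (z \<theta> \<phi>) (axis i 1) (axis i 1)) =
        f2 (z \<theta> \<phi>) (sphere_point (\<theta>, \<phi>)) (sphere_point (\<theta>, \<phi>))
        + f2 (z \<theta> \<phi>) (\<alpha> \<theta> \<phi>) (\<alpha> \<theta> \<phi>) + f2 (z \<theta> \<phi>) (\<beta> \<phi>) (\<beta> \<phi>)"
      unfolding \<alpha>_def \<beta>_def by (rule trace_spherical_frame [symmetric])
    show ?thesis
      unfolding A'_def B'_def tr fb
      by (simp add: blinfun.scaleR_right blinfun.scaleR_left blinfun.minus_right algebra_simps)
  qed
  have "integral (cbox (0, 0) (pi, 2 * pi)) (\<lambda>\<sigma>. A' (fst \<sigma>) (snd \<sigma>) + B' (fst \<sigma>) (snd \<sigma>)) = 0"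
    using IA IB cA cB by (subst integral_add) (auto simp: case_prod_unfold intro!: integrable_continuous intro: continuous_on_subset)
  then have "sphere_avg (\<lambda>\<omega>. t * (\<Sum>i\<in>UNIV. f2 (y + t *\<^sub>R \<omega>) (axis i 1) (axis i 1))
      - (2 * f1 (y + t *\<^sub>R \<omega>) \<omega> + t * f2 (y + t *\<^sub>R \<omega>) \<omega> \<omega>)) = 0"
    unfolding eq z_def sphere_avg_def by simp
  moreover have "(\<Sum>i\<in>UNIV. V0dd (axis i 1) y t) - V2 y t = sphere_avg (\<lambda>\<omega>. t * (\<Sum>i\<in>UNIV. f2 (y + t *\<^sub>R \<omega>) (axis i 1) (axis i 1))
      - (2 * f1 (y + t *\<^sub>R \<omega>) \<omega> + t * f2 (y + t *\<^sub>R \<omega>) \<omega> \<omega>))"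
  proof -
    have c: "continuous_on UNIV (\<lambda>\<omega>. t * f2 (y + t *\<^sub>R \<omega>) e e')" for e e'
      by (intro continuous_intros)
    have "V0dd e1 y t + V0dd e2 y t + V0dd e3 y t = sphere_avg (\<lambda>\<omega>. t * f2 (y + t *\<^sub>R \<omega>) e1 e1
       + t * f2 (y + t *\<^sub>R \<omega>) e2 e2 + t * f2 (y + t *\<^sub>R \<omega>) e3 e3)" for e1 e2 e3
      unfolding V0dd_def
      using sphere_avg_linear [OF c [of e1 e1] c [of e2 e2], of 1 1]
        sphere_avg_linear [OF continuous_on_add [OF c [of e1 e1] c [of e2 e2]] c [of e3 e3], of 1 1] by simp
    then have s: "(\<Sum>i\<in>UNIV. V0dd (axis i 1) y t) = sphere_avg (\<lambda>\<omega>. t * (\<Sum>i\<in>UNIV. f2 (y + t *\<^sub>R \<omega>) (axis i 1) (axis i 1)))"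
      by (simp add: sum_3 distrib_left)
    have "continuous_on UNIV (\<lambda>\<omega>. t * (\<Sum>i\<in>UNIV. f2 (y + t *\<^sub>R \<omega>) (axis i 1) (axis i 1)))"
       "continuous_on UNIV (\<lambda>\<omega>. 2 * f1 (y + t *\<^sub>R \<omega>) \<omega> + t * f2 (y + t *\<^sub>R \<omega>) \<omega> \<omega>)"
      by (intro continuous_intros)+
    from sphere_avg_diff [OF this] show ?thesis
      unfolding s V2_def by simp
  qed
  ultimately show ?thesis by simp
qed

end

text \<open>To be read on a line in direction \<open>i\<close>, with \<open>q\<close> the coordinate
  offset from the centre, \<open>A\<close> the partial derivative of u, \<open>B\<close> = u,
  \<open>C\<close> its time derivative and \<open>D\<close> its second time derivative. The powers
  of \<open>r\<close> in the field are such that all terms with \<open>A\<close> and with the mixed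
  derivative \<open>A1\<close> cancel.\<close>

lemma kirchhoff_field_deriv:
  fixes A B C q r :: "real \<Rightarrow> real"
  assumes "(r has_real_derivative q s / r s) (at s)" "(q has_real_derivative 1) (at s)" "r s > 0"
    and "(A has_real_derivative A0 + q s / r s * A1) (at s)"
    and "(B has_real_derivative A s + q s / r s * C s) (at s)"
    and "(C has_real_derivative A1 + q s / r s * D) (at s)"
  shows "((\<lambda>s. A s / r s + q s * (B s / r s ^ 3 - C s / r s ^ 2)) has_real_derivative
     A0 / r s + (B s / r s ^ 3 - C s / r s ^ 2)
      + (q s)\<^sup>2 * (3 * C s / r s ^ 4 - 3 * B s / r s ^ 5 - D / r s ^ 3)) (at s)"
proof -
  \<comment> \<open>With the inverse distance as variable every expression is polynomial and the
    cancellation is plain ring arithmetic.\<close>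
  define \<rho> where "\<rho> s = inverse (r s)" for s
  have \<rho>: "(\<rho> has_real_derivative - (q s * \<rho> s ^ 3)) (at s)"
    unfolding \<rho>_def [abs_def] using assms(3)
    by (intro DERIV_cong [OF DERIV_inverse' [OF assms(1)]])
      (auto simp: field_simps eval_nat_numeral)
  have eq: "A s / r s + q s * (B s / r s ^ 3 - C s / r s ^ 2) =
      A s * \<rho> s + q s * (B s * \<rho> s ^ 3 - C s * \<rho> s ^ 2)" for s
    by (simp add: \<rho>_def divide_inverse power_inverse)
  have "((\<lambda>s. A s * \<rho> s + q s * (B s * \<rho> s ^ 3 - C s * \<rho> s ^ 2)) has_real_derivative
      A0 * \<rho> s + (B s * \<rho> s ^ 3 - C s * \<rho> s ^ 2)
      + (q s)\<^sup>2 * (3 * C s * \<rho> s ^ 4 - 3 * B s * \<rho> s ^ 5 - D * \<rho> s ^ 3)) (at s)"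
    by (rule DERIV_cong [OF DERIV_add [OF DERIV_mult' [OF assms(4) \<rho>] DERIV_mult' [OF assms(2)
      DERIV_diff [OF DERIV_mult' [OF assms(5) DERIV_power [OF \<rho>]] DERIV_mult' [OF assms(6) DERIV_power [OF \<rho>]]]]]])
      (simp add: divide_inverse \<rho>_def [symmetric] algebra_simps eval_nat_numeral)
  then show ?thesis
    unfolding eq by (simp add: \<rho>_def divide_inverse power_inverse)
qed

text \<open>Smoothing the distance removes the singularity of the Kirchhoff field at its centre; the price is
  the divergence \<open>kirchhoff_source\<close>, which concentrates at the centre as \<open>\<epsilon>\<close> tends to \<open>0\<close>.\<close>

definition soft_dist :: "real \<Rightarrow> real^3 \<Rightarrow> real^3 \<Rightarrow> real" where
  "soft_dist \<epsilon> p y = sqrt (\<epsilon>\<^sup>2 + (norm (y - p))\<^sup>2)"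

lemma soft_dist_pos: "\<epsilon> > 0 \<Longrightarrow> soft_dist \<epsilon> p y > 0"
  unfolding soft_dist_def by (simp add: add_pos_nonneg)

lemma continuous_on_soft_dist [continuous_intros]:
  assumes "continuous_on S e" "continuous_on S g"
  shows "continuous_on S (\<lambda>x. soft_dist (e x) p (g x))"
  unfolding soft_dist_def by (intro continuous_intros assms)

text \<open>Smoothing preserves the rule r' = q / r of the true distance, so
  \<open>kirchhoff_field_deriv\<close> applies unchanged; only the sum of the squared offsets
  becomes \<open>r\<^sup>2 - \<epsilon>\<^sup>2\<close>.\<close>

lemma deriv_soft_dist:
  assumes "\<epsilon> > 0"
  shows "((\<lambda>s. soft_dist \<epsilon> p (y + s *\<^sub>R axis i 1)) has_real_derivative
    (y $ i + s - p $ i) / soft_dist \<epsilon> p (y + s *\<^sub>R axis i 1)) (at s)"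
proof -
  have sq: "(norm (w + s *\<^sub>R axis i 1))\<^sup>2 = (norm w)\<^sup>2 + (2 * (w $ i) * s + s\<^sup>2)" for w :: "real^3" and s
    unfolding power2_norm_eq_inner
    by (simp add: inner_add_left inner_add_right inner_axis inner_axis' power2_eq_square distrib_left)
  have eq: "(norm (y + s *\<^sub>R axis i 1 - p))\<^sup>2 =
      (norm (y - p))\<^sup>2 + (2 * (y $ i - p $ i) * s + s\<^sup>2)" for s
    using sq [of "y - p" s] by (simp only: vector_minus_component diff_add_eq)
  let ?R = "\<lambda>s. \<epsilon>\<^sup>2 + ((norm (y - p))\<^sup>2 + (2 * (y $ i - p $ i) * s + s\<^sup>2))"
  have pos: "0 < ?R s"
    using assms zero_le_power2 [of "norm (y + s *\<^sub>R axis i 1 - p)"] unfolding eq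
    by (intro add_pos_nonneg) auto
  have dR: "(?R has_real_derivative 2 * (y $ i + s - p $ i)) (at s)"
    by (auto intro!: derivative_eq_intros)
  have half: "inverse X / 2 * (2 * q) = q / X" for X q :: real
    by (simp add: field_simps)
  show ?thesis
    unfolding soft_dist_def eq
    by (rule DERIV_cong [OF DERIV_chain2 [where g = ?R, OF DERIV_real_sqrt [OF pos] dR] half])
qed

context c2_function
begin

definition kirchhoff_field :: "real \<Rightarrow> real^3 \<Rightarrow> real \<Rightarrow> 3 \<Rightarrow> real^3 \<Rightarrow> real" where
  "kirchhoff_field \<epsilon> p \<tau> i y = (let r = soft_dist \<epsilon> p y in
     V0d (axis i 1) y (\<tau> + r) / r + (y $ i - p $ i) * (V0 y (\<tau> + r) / r ^ 3 - V1 y (\<tau> + r) / r ^ 2))"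

definition kirchhoff_source :: "real \<Rightarrow> real^3 \<Rightarrow> real \<Rightarrow> real^3 \<Rightarrow> real" where
  "kirchhoff_source \<epsilon> p \<tau> y = (let r = soft_dist \<epsilon> p y in
     \<epsilon>\<^sup>2 * (3 * V0 y (\<tau> + r) - 3 * r * V1 y (\<tau> + r) + r\<^sup>2 * V2 y (\<tau> + r)) / r ^ 5)"

text \<open>In the divergence the Laplacian becomes \<open>V2\<close> by the wave equation. If the
  squared offsets added up to \<open>r\<^sup>2\<close>, everything would cancel; their defect
  \<open>\<epsilon>\<^sup>2\<close> leaves exactly \<open>kirchhoff_source\<close>.\<close>

lemma kirchhoff_flux:
  assumes "\<epsilon> > 0" "a \<ge> 0"
  shows "(\<Sum>i\<in>UNIV. face_integral a (\<lambda>\<eta>. kirchhoff_field \<epsilon> p \<tau> i (plane_point i a \<eta>)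
      - kirchhoff_field \<epsilon> p \<tau> i (plane_point i (- a) \<eta>))) = box_integral a (kirchhoff_source \<epsilon> p \<tau>)"
proof -
  define r where "r y = soft_dist \<epsilon> p y" for y
  define K where "K i y = V0dd (axis i 1) y (\<tau> + r y) / r y
      + (V0 y (\<tau> + r y) / r y ^ 3 - V1 y (\<tau> + r y) / r y ^ 2)
      + (y $ i - p $ i)\<^sup>2 * (3 * V1 y (\<tau> + r y) / r y ^ 4 - 3 * V0 y (\<tau> + r y) / r y ^ 5
          - V2 y (\<tau> + r y) / r y ^ 3)" for i y
  have r: "r y > 0" for y
    unfolding r_def by (rule soft_dist_pos [OF assms(1)])
  then have r_ne: "r y \<noteq> 0" for y
    by (metis less_irrefl)
  have cr [continuous_intros]: "continuous_on S r" for S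
    unfolding r_def [abs_def] by (intro continuous_intros)
  have cr' [continuous_intros]: "continuous_on S (\<lambda>x. r (h x))" if "continuous_on S h" for S :: "'z::t2_space set" and h
    by (rule continuous_on_compose2 [OF cr that subset_UNIV])
  have cK: "continuous_on UNIV (K i)" for i
    unfolding K_def [abs_def] by (intro continuous_intros) (simp_all add: r_ne)
  have cK': "continuous_on S (\<lambda>z :: real \<times> real \<times> real. K i (vector [fst z, fst (snd z), snd (snd z)]))" for S i
    by (rule continuous_on_compose2 [OF cK]) (intro continuous_on_vector_3 continuous_intros, simp)
  have dr: "((\<lambda>s. r (y + s *\<^sub>R axis i 1)) has_real_derivative
      (y $ i + s - p $ i) / r (y + s *\<^sub>R axis i 1)) (at s)" for y i s
    unfolding r_def by (rule deriv_soft_dist [OF assms(1)])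
  have dK: "((\<lambda>s. kirchhoff_field \<epsilon> p \<tau> i (y + s *\<^sub>R axis i 1)) has_real_derivative K i y) (at 0)" for i y
  proof -
    define t where "t s = \<tau> + r (y + s *\<^sub>R axis i 1)" for s
    define t' where "t' s = (y $ i + s - p $ i) / r (y + s *\<^sub>R axis i 1)" for s
    have dt: "(t has_real_derivative t' s) (at s)" for s
      unfolding t_def [abs_def] t'_def by (auto intro!: derivative_eq_intros dr)
    have ct': "continuous_on UNIV t'"
      unfolding t'_def [abs_def] by (intro continuous_intros) (simp_all add: r_ne)
    have q: "((\<lambda>s. y $ i + s - p $ i) has_real_derivative 1) (at 0)"
      by (auto intro!: derivative_eq_intros)
    note dV = deriv_V0d [OF dt ct', of "axis i 1" y 0] deriv_V0 [OF dt ct', of y "axis i 1" 0]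
      deriv_V1 [OF dt ct', of y "axis i 1" 0]
    show ?thesis
      using kirchhoff_field_deriv [OF dr [of y i 0] q r dV [unfolded t'_def]]
      by (simp add: t_def K_def kirchhoff_field_def Let_def r_def [symmetric])
  qed
  have "(\<Sum>i\<in>UNIV. face_integral a (\<lambda>\<eta>. kirchhoff_field \<epsilon> p \<tau> i (plane_point i a \<eta>)
      - kirchhoff_field \<epsilon> p \<tau> i (plane_point i (- a) \<eta>))) = (\<Sum>i\<in>UNIV. box_integral a (K i))"
    by (rule sum.cong [OF refl], rule box_integral_partial [OF dK cK assms(2), symmetric])
  also have "\<dots> = box_integral a (\<lambda>y. \<Sum>i\<in>UNIV. K i y)"
    unfolding box_integral_def case_prod_unfold
    by (rule integral_sum [symmetric]) (auto intro: integrable_continuous cK')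
  also have "(\<lambda>y. \<Sum>i\<in>UNIV. K i y) = kirchhoff_source \<epsilon> p \<tau>"
  proof
    fix y
    define R B C D where "R = r y" and "B = V0 y (\<tau> + r y)" and "C = V1 y (\<tau> + r y)" and "D = V2 y (\<tau> + r y)"
    have R: "R > 0" using r R_def by simp
    have "(norm (y - p))\<^sup>2 = (\<Sum>i\<in>UNIV. (y $ i - p $ i)\<^sup>2)"
      by (simp add: norm_vec_def L2_set_def sum_nonneg)
    then have q2: "(\<Sum>i\<in>UNIV. (y $ i - p $ i)\<^sup>2) = R\<^sup>2 - \<epsilon>\<^sup>2"
      by (simp add: R_def r_def soft_dist_def sum_nonneg)
    have "(\<Sum>i\<in>UNIV. K i y) = D / R + 3 * (B / R ^ 3 - C / R ^ 2)
        + (R\<^sup>2 - \<epsilon>\<^sup>2) * (3 * C / R ^ 4 - 3 * B / R ^ 5 - D / R ^ 3)"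
      unfolding K_def sum.distrib sum_distrib_right [symmetric] sum_divide_distrib [symmetric] wave_equation q2
      by (simp add: R_def [symmetric] B_def C_def D_def)
    also have "\<dots> = \<epsilon>\<^sup>2 * (3 * B - 3 * R * C + R\<^sup>2 * D) / R ^ 5"
      using R by (simp add: divide_simps) (simp add: algebra_simps eval_nat_numeral)
    finally show "(\<Sum>i\<in>UNIV. K i y) = kirchhoff_source \<epsilon> p \<tau> y"
      by (simp add: kirchhoff_source_def Let_def r_def R_def B_def C_def D_def)
  qed
  finally show ?thesis .
qed

end

section \<open>Concentration at the centre\<close>

lemma tendsto_bell: "((\<lambda>s::real. s / sqrt (1 + s\<^sup>2)) \<longlongrightarrow> 1) at_top"
proof -
  have "((\<lambda>s::real. 1 / sqrt ((inverse s)\<^sup>2 + 1)) \<longlongrightarrow> 1 / sqrt (0\<^sup>2 + 1)) at_top"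
    by (intro tendsto_intros tendsto_inverse_0_at_top filterlim_ident) auto
  moreover have "\<forall>\<^sub>F s::real in at_top. 1 / sqrt ((inverse s)\<^sup>2 + 1) = s / sqrt (1 + s\<^sup>2)"
    using eventually_gt_at_top [of 0]
  proof eventually_elim
    case (elim s)
    have "(inverse s)\<^sup>2 + 1 = (1 + s\<^sup>2) / s\<^sup>2"
      using elim by (simp add: field_simps)
    then show ?case
      using elim by (simp add: real_sqrt_divide)
  qed
  ultimately show ?thesis
    using tendsto_cong by fastforce
qed

lemma DERIV_sqrt_one_plus_square:
  "((\<lambda>s. sqrt (1 + s\<^sup>2)) has_real_derivative s / sqrt (1 + s\<^sup>2)) (at s)"
proof -
  have "1 + s\<^sup>2 > 0" by (simp add: add_pos_nonneg)
  then show ?thesis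
    by (auto intro!: derivative_eq_intros simp: field_simps)
qed

text \<open>For \<open>nn_integral_bell\<close>: up to the factor 4 pi / 3, the fifth power of this
  function is the primitive that remains after the layer cake.\<close>

lemma DERIV_bell:
  "((\<lambda>s. s / sqrt (1 + s\<^sup>2)) has_real_derivative 1 / sqrt (1 + s\<^sup>2) ^ 3) (at s)"
proof -
  define r where "r = sqrt (1 + s\<^sup>2)"
  have "1 + s\<^sup>2 > 0" by (simp add: add_pos_nonneg)
  then have r: "r > 0" "r * r = 1 + s * s"
    by (simp_all add: r_def power2_eq_square)
  have "((\<lambda>s. s / sqrt (1 + s\<^sup>2)) has_real_derivative (1 * r - s * (s / r)) / (r * r)) (at s)"
    unfolding r_def using r(1) unfolding r_def
    by (intro DERIV_divide DERIV_sqrt_one_plus_square DERIV_ident) auto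
  moreover have "(1 * r - s * (s / r)) / (r * r) = 1 / r ^ 3"
  proof -
    have "1 * r - s * (s / r) = (r * r - s * s) / r" using r(1) by (simp add: field_simps)
    also have "r * r - s * s = 1" using r by simp
    finally show ?thesis by (simp add: eval_nat_numeral)
  qed
  ultimately show ?thesis by (simp add: r_def)
qed

text \<open>The profile of \<open>kirchhoff_source\<close> at scale \<epsilon>: the Jacobian
  \<open>\<epsilon>^3\<close> times \<open>\<epsilon>\<^sup>2 / r^5\<close> at distance \<epsilon> s
  from the centre.\<close>

definition bell :: "real \<Rightarrow> real" where
  "bell s = 1 / sqrt (1 + s\<^sup>2) ^ 5"

lemma one_plus_square_pos [simp]:
  fixes s :: real
  shows "1 + s\<^sup>2 > 0" "1 + s\<^sup>2 \<noteq> 0" "1 + s * s \<noteq> 0"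
proof -
  show "1 + s\<^sup>2 > 0" by (simp add: add_pos_nonneg)
  then show "1 + s\<^sup>2 \<noteq> 0" "1 + s * s \<noteq> 0" by (simp_all add: power2_eq_square)
qed

text \<open>Layer cake: \<open>bell \<rho>\<close> is the integral of \<open>5 s / (1 + s\<^sup>2) powr (7/2)\<close> over \<open>s \<ge> \<rho>\<close>, so that
  by Tonelli only volumes of balls are needed.\<close>

lemma nn_integral_bell:
  "(\<integral>\<^sup>+ q. ennreal (bell (norm (q :: real \<times> real \<times> real))) \<partial>lborel) = ennreal (4 * pi / 3)"
proof -
  define g where "g s = 5 * s / sqrt (1 + s\<^sup>2) ^ 7" for s :: real
  have [measurable]: "g \<in> borel_measurable borel"
    unfolding g_def by (intro borel_measurable_continuous_onI continuous_intros) auto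
  have pos: "g s \<ge> 0" if "s \<ge> 0" for s
    unfolding g_def using that by (simp add: less_imp_le)
  have bell: "(\<integral>\<^sup>+ s. ennreal (g s) * indicator {\<rho>..} s \<partial>lborel) = ennreal (bell \<rho>)"
    if "\<rho> \<ge> 0" for \<rho>
  proof -
    have "(\<integral>\<^sup>+ s. ennreal (g s) * indicator {\<rho>..} s \<partial>lborel) = ennreal (0 - (- bell \<rho>))"
    proof (rule nn_integral_FTC_atLeast)
      show "((\<lambda>s. - bell s) has_real_derivative g s) (at s)" for s
      proof -
        have eq: "- bell s = - (inverse (sqrt (1 + s\<^sup>2)) ^ 5)" for s
          by (simp add: bell_def divide_inverse power_inverse)
        show ?thesis
          unfolding eq
          by (rule DERIV_cong [OF DERIV_minus [OF DERIV_power [OF DERIV_inverse' [OF DERIV_sqrt_one_plus_square]]]])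
            (auto simp: g_def field_simps eval_nat_numeral)
      qed
      have "filterlim (\<lambda>s::real. sqrt (1 + s\<^sup>2)) at_top at_top"
      proof (rule filterlim_at_top_mono [OF filterlim_ident])
        show "\<forall>\<^sub>F s::real in at_top. s \<le> sqrt (1 + s\<^sup>2)"
          by (intro always_eventually allI real_le_rsqrt) simp
      qed
      then have "((\<lambda>s. - (inverse (sqrt (1 + s\<^sup>2)) ^ 5)) \<longlongrightarrow> - (0 ^ 5)) at_top"
        by (intro tendsto_intros tendsto_inverse_0_at_top)
      then show "((\<lambda>s. - bell s) \<longlongrightarrow> 0) at_top"
        by (simp add: bell_def divide_inverse power_inverse)
    qed (use that pos in auto)
    then show ?thesis by simp
  qed
  have "(\<integral>\<^sup>+ q. ennreal (bell (norm (q :: real \<times> real \<times> real))) \<partial>lborel)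
      = (\<integral>\<^sup>+ q. \<integral>\<^sup>+ s. ennreal (g s) * indicator {norm (q :: real \<times> real \<times> real)..} s \<partial>lborel \<partial>lborel)"
    by (simp add: bell)
  also have "\<dots> = (\<integral>\<^sup>+ s. \<integral>\<^sup>+ q. ennreal (g s) * indicator {norm (q :: real \<times> real \<times> real)..} s \<partial>lborel \<partial>lborel)"
  proof (rule lborel_pair.Fubini')
    have "(\<lambda>x. ennreal (g (fst x)) * indicator {x. norm (snd x) \<le> fst x} x)
        \<in> borel_measurable (borel :: (real \<times> real \<times> real \<times> real) measure)"
      by (intro borel_measurable_times_ennreal borel_measurable_indicator
          borel_closed closed_Collect_le continuous_intros measurable_compose [OF _ measurable_ennreal]
          measurable_compose [OF _ \<open>g \<in> borel_measurable borel\<close>] borel_measurable_continuous_onI)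
    moreover have "(\<lambda>(s, q). ennreal (g s) * indicator {norm (q :: real \<times> real \<times> real)..} s) =
        (\<lambda>x. ennreal (g (fst x)) * indicator {x. norm (snd x) \<le> fst x} x)"
      by (auto simp: fun_eq_iff indicator_def)
    ultimately show "(\<lambda>(s, q). ennreal (g s) * indicator {norm (q :: real \<times> real \<times> real)..} s)
        \<in> borel_measurable (lborel \<Otimes>\<^sub>M lborel)"
      by (simp add: lborel_prod)
  qed
  also have "\<dots> = (\<integral>\<^sup>+ s. ennreal (5 * 4 / 3 * pi * s ^ 4 / sqrt (1 + s\<^sup>2) ^ 7) * indicator {0..} s \<partial>lborel)"
  proof (rule nn_integral_cong)
    fix s :: real
    have "(\<integral>\<^sup>+ q. ennreal (g s) * indicator {norm (q :: real \<times> real \<times> real)..} s \<partial>lborel) =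
        (\<integral>\<^sup>+ q. ennreal (g s) * indicator (cball (0 :: real \<times> real \<times> real) s) q \<partial>lborel)"
      by (intro nn_integral_cong) (auto simp: indicator_def)
    also have "\<dots> = ennreal (g s) * emeasure lborel (cball (0 :: real \<times> real \<times> real) s)"
      by (rule nn_integral_cmult_indicator) auto
    also have "\<dots> = ennreal (5 * 4 / 3 * pi * s ^ 4 / sqrt (1 + s\<^sup>2) ^ 7) * indicator {0..} s"
    proof (cases "s \<ge> 0")
      case True
      then show ?thesis
        by (simp add: emeasure_cball unit_ball_vol_3 ennreal_mult [symmetric] pos g_def field_simps eval_nat_numeral)
    qed auto
    finally show "(\<integral>\<^sup>+ q. ennreal (g s) * indicator {norm (q :: real \<times> real \<times> real)..} s \<partial>lborel) =
        ennreal (5 * 4 / 3 * pi * s ^ 4 / sqrt (1 + s\<^sup>2) ^ 7) * indicator {0..} s" .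
  qed
  \<comment> \<open>The total mass is the increment of the primitive from 0 to infinity, where s /
    sqrt (1 + s^2) runs from 0 to 1.\<close>
  also have "\<dots> = ennreal (4 / 3 * pi * 1 ^ 5 - 4 / 3 * pi * (0 / sqrt (1 + 0\<^sup>2)) ^ 5)"
  proof (rule nn_integral_FTC_atLeast)
    show "(\<lambda>s::real. 5 * 4 / 3 * pi * s ^ 4 / sqrt (1 + s\<^sup>2) ^ 7) \<in> borel_measurable borel"
      by (intro borel_measurable_continuous_onI continuous_intros) auto
    show "((\<lambda>s. 4 / 3 * pi * (s / sqrt (1 + s\<^sup>2)) ^ 5) has_real_derivative
        5 * 4 / 3 * pi * s ^ 4 / sqrt (1 + s\<^sup>2) ^ 7) (at s)" for s
      by (rule DERIV_cong [OF DERIV_cmult [OF DERIV_power [OF DERIV_bell]]])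
        (auto simp: field_simps eval_nat_numeral)
    show "((\<lambda>s::real. 4 / 3 * pi * (s / sqrt (1 + s\<^sup>2)) ^ 5) \<longlongrightarrow> 4 / 3 * pi * 1 ^ 5) at_top"
      by (intro tendsto_intros tendsto_bell)
  qed auto
  finally show ?thesis by (simp add: mult_ac)
qed

lemma integrable_bell: "integrable lborel (\<lambda>q :: real \<times> real \<times> real. bell (norm q))"
  and integral_bell: "(LINT q|lborel. bell (norm (q :: real \<times> real \<times> real))) = 4 * pi / 3"
proof -
  have m: "(\<lambda>q :: real \<times> real \<times> real. bell (norm q)) \<in> borel_measurable lborel"
  proof -
    have "(\<lambda>q :: real \<times> real \<times> real. bell (norm q)) \<in> borel_measurable borel"
      unfolding bell_def by (intro borel_measurable_continuous_onI continuous_intros) auto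
    then show ?thesis by simp
  qed
  have nn: "bell s \<ge> 0" for s
    by (simp add: bell_def less_imp_le)
  show int: "integrable lborel (\<lambda>q :: real \<times> real \<times> real. bell (norm q))"
    by (rule integrableI_nonneg [OF m]) (auto simp: nn nn_integral_bell)
  show "(LINT q|lborel. bell (norm (q :: real \<times> real \<times> real))) = 4 * pi / 3"
    using integral_eq_nn_integral [OF m] by (simp add: nn nn_integral_bell)
qed

section \<open>Rescaling box integrals around the centre\<close>

definition vec3 :: "real \<times> real \<times> real \<Rightarrow> real^3" where
  "vec3 u = vector [fst u, fst (snd u), snd (snd u)]"

lemma continuous_on_vec3 [continuous_intros]:
  "continuous_on S g \<Longrightarrow> continuous_on S (\<lambda>x. vec3 (g x))"
  unfolding vec3_def by (intro continuous_on_vector_3 continuous_intros)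

lemma vec3_nth [simp]: "vec3 u $ 1 = fst u" "vec3 u $ 2 = fst (snd u)" "vec3 u $ 3 = snd (snd u)"
  by (simp_all add: vec3_def)

lemma norm_vec3_diff: "norm (vec3 u - vec3 v) = norm (u - v)"
  by (cases u; cases v) (simp add: norm_vec3 norm_Pair)

text \<open>Moves to a Lebesgue integral over the whole space, where the affine substitution and
  dominated convergence can be used.\<close>

lemma box_integral_eq:
  assumes "continuous_on UNIV g"
  shows "box_integral a g =
    (LINT u|lborel. indicator (cbox (- a, - a, - a) (a, a, a)) u * g (vec3 u))"
proof -
  let ?B = "cbox (- a, - a, - a) (a, a, a)"
  have "set_integrable lborel ?B (\<lambda>u. g (vec3 u))"
    unfolding set_integrable_def
    by (intro borel_integrable_compact compact_cbox continuous_on_compose2 [OF assms] continuous_intros) auto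
  from set_borel_integral_eq_integral(2) [OF this] show ?thesis
    by (simp add: box_integral_def vec3_def set_lebesgue_integral_def case_prod_unfold)
qed

lemma lborel_integral_affine:
  fixes g :: "'a::euclidean_space \<Rightarrow> real"
  assumes "g \<in> borel_measurable borel" "\<epsilon> > 0"
  shows "(LINT u|lborel. g u) = (LINT q|lborel. \<epsilon> ^ DIM('a) * g (P + \<epsilon> *\<^sub>R q))"
proof -
  have "(LINT u|lborel. g u) =
      (LINT u|density (distr lborel borel (\<lambda>x. P + \<epsilon> *\<^sub>R x)) (\<lambda>_. ennreal (\<bar>\<epsilon>\<bar> ^ DIM('a))). g u)"
    using lborel_affine [of \<epsilon> P] assms(2) by (simp add: ennreal_power)
  also have "\<dots> = (LINT u|distr lborel borel (\<lambda>x. P + \<epsilon> *\<^sub>R x). \<epsilon> ^ DIM('a) * g u)"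
    using assms by (subst integral_density) auto
  also have "\<dots> = (LINT q|lborel. \<epsilon> ^ DIM('a) * g (P + \<epsilon> *\<^sub>R q))"
    using assms by (subst integral_distr) auto
  finally show ?thesis .
qed

lemma soft_dist_vec3: "\<epsilon> \<ge> 0 \<Longrightarrow> soft_dist \<epsilon> (vec3 P) (vec3 (P + \<epsilon> *\<^sub>R q)) = \<epsilon> * sqrt (1 + (norm q)\<^sup>2)"
proof -
  assume \<epsilon>: "\<epsilon> \<ge> 0"
  have "soft_dist \<epsilon> (vec3 P) (vec3 (P + \<epsilon> *\<^sub>R q)) = sqrt (\<epsilon>\<^sup>2 * (1 + (norm q)\<^sup>2))"
    using \<epsilon> by (simp add: soft_dist_def norm_vec3_diff power_mult_distrib distrib_left)
  then show ?thesis using \<epsilon> by (simp add: real_sqrt_mult)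
qed

text \<open>Substituting P + \<epsilon> q turns the kernel into the fixed function
  \<open>bell\<close>, while the box, seen from \<open>P\<close>, swells to the whole space or
  recedes to infinity. A boundary point would see only a fraction of the space and is
  excluded.\<close>

lemma concentration:
  fixes H :: "real^3 \<Rightarrow> real \<Rightarrow> real"
  assumes H: "continuous_on UNIV (\<lambda>(y, s). H y s)"
    and P: "P \<in> box (- a, - a, - a) (a, a, a) \<or> P \<notin> cbox (- a, - a, - a) (a, a, a)"
    and \<epsilon>: "\<epsilon> \<longlonglongrightarrow> 0" "\<And>n. 0 < \<epsilon> n" "\<And>n. \<epsilon> n \<le> 1"
  shows "(\<lambda>n. box_integral a (\<lambda>y. (\<epsilon> n)\<^sup>2 * H y (soft_dist (\<epsilon> n) (vec3 P) y) / soft_dist (\<epsilon> n) (vec3 P) y ^ 5))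
    \<longlonglongrightarrow> (if P \<in> box (- a, - a, - a) (a, a, a) then 4 * pi / 3 * H (vec3 P) 0 else 0)"
proof -
  let ?B = "cbox (- a, - a, - a) (a, a, a)" and ?P = "vec3 P"
  define h where "h e u = H (vec3 u) (soft_dist e ?P (vec3 u))" for e u
  have cH: "continuous_on S (\<lambda>x. H (y x) (s x))"
    if "continuous_on S y" "continuous_on S s" for S :: "'z::t2_space set" and y s
    using continuous_on_compose2 [OF H continuous_on_Pair [OF that]] by simp
  have ch: "continuous_on S (\<lambda>x. h (e x) (u x))" if "continuous_on S e" "continuous_on S u" for S :: "'z::t2_space set" and e u
    unfolding h_def by (intro cH continuous_intros that)
  \<comment> \<open>Compactness in \<epsilon> and the point together gives one bound for all members
    of the sequence, hence the dominating function \<open>M * bell\<close>; the bound 1 on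
    \<epsilon> serves this purpose.\<close>
  have "compact ((\<lambda>x. h (fst x) (snd x)) ` ({0..1} \<times> ?B))"
    by (intro compact_continuous_image ch continuous_intros compact_Times) auto
  then obtain M where "M > 0" and "\<forall>x \<in> (\<lambda>x. h (fst x) (snd x)) ` ({0..1} \<times> ?B). norm x \<le> M"
    using compact_imp_bounded bounded_pos by blast
  then have "M \<ge> 0" and M: "\<And>e u. e \<in> {0..1} \<Longrightarrow> u \<in> ?B \<Longrightarrow> \<bar>h e u\<bar> \<le> M"
    by auto
  define F where "F n q = indicator ?B (P + \<epsilon> n *\<^sub>R q) * (h (\<epsilon> n) (P + \<epsilon> n *\<^sub>R q) * bell (norm q))" for n q
  have eq: "box_integral a (\<lambda>y. (\<epsilon> n)\<^sup>2 * H y (soft_dist (\<epsilon> n) ?P y) / soft_dist (\<epsilon> n) ?P y ^ 5)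
      = (LINT q|lborel. F n q)" for n
  proof -
    have ne: "soft_dist (\<epsilon> n) p y \<noteq> 0" for p y
      using soft_dist_pos [OF \<epsilon>(2), of n p y] by simp
    have c: "continuous_on UNIV (\<lambda>y. (\<epsilon> n)\<^sup>2 * H y (soft_dist (\<epsilon> n) ?P y) / soft_dist (\<epsilon> n) ?P y ^ 5)"
      by (intro continuous_intros cH) (simp_all add: ne)
    have m: "(\<lambda>u. indicator ?B u * ((\<epsilon> n)\<^sup>2 * h (\<epsilon> n) u / soft_dist (\<epsilon> n) ?P (vec3 u) ^ 5)) \<in> borel_measurable borel"
      by (intro borel_measurable_times borel_measurable_indicator borel_closed closed_cbox
          borel_measurable_continuous_onI continuous_intros ch) (simp_all add: ne)
    show ?thesis
      unfolding box_integral_eq [OF c] h_def [symmetric]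
      unfolding lborel_integral_affine [OF m \<epsilon>(2) [of n], of P]
    proof (rule Bochner_Integration.integral_cong [OF refl])
      fix q :: "real \<times> real \<times> real"
      have e: "\<epsilon> n > 0" by (rule \<epsilon>)
      have dim: "DIM(real \<times> real \<times> real) = 3" by simp
      \<comment> \<open>The powers 3 (Jacobian), 2 (source) and -5 (distance) of \<epsilon>
        cancel.\<close>
      have scale: "e ^ 3 * (i * (e\<^sup>2 * x / (e * r) ^ 5)) = i * (x * (1 / r ^ 5))" if "e > 0" for e i x r :: real
        using that by (cases "r = 0") (simp_all add: power_mult_distrib field_simps eval_nat_numeral)
      show "\<epsilon> n ^ DIM(real \<times> real \<times> real) * (indicator ?B (P + \<epsilon> n *\<^sub>R q) *
        ((\<epsilon> n)\<^sup>2 * h (\<epsilon> n) (P + \<epsilon> n *\<^sub>R q) / soft_dist (\<epsilon> n) ?P (vec3 (P + \<epsilon> n *\<^sub>R q)) ^ 5)) = F n q"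
        unfolding F_def bell_def soft_dist_vec3 [OF less_imp_le [OF e]] dim by (rule scale [OF e])
    qed
  qed
  let ?c = "if P \<in> box (- a, - a, - a) (a, a, a) then 1 else 0 :: real"
  have "(\<lambda>n. LINT q|lborel. F n q) \<longlonglongrightarrow> (LINT q|lborel. ?c * H ?P 0 * bell (norm (q :: real \<times> real \<times> real)))"
  proof (rule integral_dominated_convergence [where w = "\<lambda>q. M * bell (norm q)"])
    show "integrable lborel (\<lambda>q :: real \<times> real \<times> real. M * bell (norm q))"
      by (intro integrable_mult_right integrable_bell)
    have mb: "(\<lambda>q :: real \<times> real \<times> real. bell (norm q)) \<in> borel_measurable lborel"
      using integrable_bell by (rule borel_measurable_integrable)
    then show "(\<lambda>q :: real \<times> real \<times> real. ?c * H ?P 0 * bell (norm q)) \<in> borel_measurable lborel"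
      by (intro borel_measurable_times borel_measurable_const)
    show "F n \<in> borel_measurable lborel" for n
    proof -
      have "(\<lambda>u. indicator ?B u) \<in> borel_measurable borel" 
        by (intro borel_measurable_indicator borel_closed closed_cbox)
      moreover have "(\<lambda>q. P + \<epsilon> n *\<^sub>R q) \<in> borel_measurable borel"
        by (intro borel_measurable_continuous_onI continuous_intros)
      ultimately have i: "(\<lambda>q. indicator ?B (P + \<epsilon> n *\<^sub>R q) :: real) \<in> borel_measurable borel"
        by (rule measurable_compose [rotated])
      have "(\<lambda>q. h (\<epsilon> n) (P + \<epsilon> n *\<^sub>R q)) \<in> borel_measurable borel"
        by (intro borel_measurable_continuous_onI continuous_intros ch)
      with i mb show ?thesis
        unfolding F_def [abs_def] by simp
    qed
    show "AE q in lborel. norm (F n q) \<le> M * bell (norm q)" for n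
    proof (rule always_eventually, rule allI)
      fix q :: "real \<times> real \<times> real"
      have "bell (norm q) \<ge> 0" by (simp add: bell_def less_imp_le)
      moreover have "\<bar>h (\<epsilon> n) (P + \<epsilon> n *\<^sub>R q)\<bar> \<le> M" if "P + \<epsilon> n *\<^sub>R q \<in> ?B"
        using M [OF _ that, of "\<epsilon> n"] \<epsilon>(2,3) [of n] by simp
      moreover note \<open>M \<ge> 0\<close>
      ultimately show "norm (F n q) \<le> M * bell (norm q)"
        by (cases "P + \<epsilon> n *\<^sub>R q \<in> ?B") (auto simp: F_def abs_mult intro: mult_right_mono)
    qed
    show "AE q in lborel. (\<lambda>n. F n q) \<longlonglongrightarrow> ?c * H ?P 0 * bell (norm q)"
    proof (rule always_eventually, rule allI)
      fix q :: "real \<times> real \<times> real"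
      have "(\<lambda>n. P + \<epsilon> n *\<^sub>R q) \<longlonglongrightarrow> P + 0 *\<^sub>R q"
        by (intro tendsto_intros \<epsilon>)
      then have l: "(\<lambda>n. P + \<epsilon> n *\<^sub>R q) \<longlonglongrightarrow> P" by simp
      have i: "(\<lambda>n. indicator ?B (P + \<epsilon> n *\<^sub>R q) :: real) \<longlonglongrightarrow> ?c"
      proof (cases "P \<in> box (- a, - a, - a) (a, a, a)")
        case True
        have "\<forall>\<^sub>F n in sequentially. P + \<epsilon> n *\<^sub>R q \<in> box (- a, - a, - a) (a, a, a)"
          using l True by (intro topological_tendstoD) auto
        then have "\<forall>\<^sub>F n in sequentially. indicator ?B (P + \<epsilon> n *\<^sub>R q) = (1 :: real)"
          by eventually_elim (use box_subset_cbox in \<open>auto simp: indicator_def\<close>)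
        then show ?thesis using True by (simp add: tendsto_eventually)
      next
        case False
        with P have "P \<in> - ?B" by simp
        then have "\<forall>\<^sub>F n in sequentially. P + \<epsilon> n *\<^sub>R q \<in> - ?B"
          using l by (intro topological_tendstoD) (auto simp: open_Compl closed_cbox)
        then have "\<forall>\<^sub>F n in sequentially. indicator ?B (P + \<epsilon> n *\<^sub>R q) = (0 :: real)"
          by eventually_elim auto
        then show ?thesis using False by (simp add: tendsto_eventually)
      qed
      have "continuous_on UNIV (\<lambda>x. h (fst x) (snd x))"
        by (intro ch continuous_intros)
      then have "isCont (\<lambda>x. h (fst x) (snd x)) (0, P)"
        using continuous_on_eq_continuous_at open_UNIV by blast
      from isCont_tendsto_compose [OF this tendsto_Pair [OF \<epsilon>(1) l]]
      have "(\<lambda>n. h (\<epsilon> n) (P + \<epsilon> n *\<^sub>R q)) \<longlonglongrightarrow> H ?P 0"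
        by (simp add: h_def soft_dist_def)
      from tendsto_mult [OF i tendsto_mult [OF this tendsto_const [of "bell (norm q)"]]]
      show "(\<lambda>n. F n q) \<longlonglongrightarrow> ?c * H ?P 0 * bell (norm q)"
        by (simp add: F_def mult.assoc)
    qed
  qed
  also have "(LINT q|lborel. ?c * H ?P 0 * bell (norm (q :: real \<times> real \<times> real))) = ?c * H ?P 0 * (4 * pi / 3)"
    by (simp only: integral_mult_right_zero integral_bell)
  finally show ?thesis unfolding eq by (simp split: if_splits add: mult_ac)
qed

section \<open>The method of images\<close>

definition parity :: "int \<Rightarrow> real" where
  "parity k = (if even k then 1 else - 1)"

text \<open>\<open>mirror a k\<close> is the map of the replication operator that takes the interval of length \<open>2 a\<close>
  centred at \<open>2 k a\<close> to \<open>(-a, a)\<close>; as \<open>k\<close> varies, \<open>mirror a k s\<close> runs through the images of \<open>s\<close> under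
  the reflections in \<open>a\<close> and \<open>-a\<close>.\<close>

definition mirror :: "real \<Rightarrow> int \<Rightarrow> real \<Rightarrow> real" where
  "mirror a k s = parity k * (s - 2 * of_int k * a)"

definition mirror2 :: "real \<Rightarrow> int \<times> int \<Rightarrow> real \<times> real \<Rightarrow> real \<times> real" where
  "mirror2 a \<kappa> \<xi> = (mirror a (fst \<kappa>) (fst \<xi>), mirror a (snd \<kappa>) (snd \<xi>))"

text \<open>Images with other indices are too far from the cube to contribute. Reflecting in the face
  \<open>\<sigma> = \<plusminus>1\<close> pairs up these indices except \<open>2 \<sigma>\<close>, whose image is also too far from that face.\<close>

definition images :: "int set" where "images = {-2, -1, 0, 1, 2}"

lemma finite_images [simp]: "finite images"
  by (simp add: images_def)

lemma sum_images: "(\<Sum>k\<in>images. g k) = g (-2) + g (-1) + g 0 + g 1 + (g 2 :: real)"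
  by (simp add: images_def)

text \<open>The trivial image is the only one in the closed cube, so only its source survives in the
  limit and no image meets the boundary.\<close>

lemma mirror_outside:
  assumes "\<bar>s\<bar> < a" "k \<noteq> 0"
  shows "\<bar>mirror a k s\<bar> > a"
proof -
  have "1 \<le> \<bar>k\<bar>" using assms by linarith
  then have "1 \<le> \<bar>of_int k :: real\<bar>" by linarith
  then have "1 * a \<le> \<bar>of_int k\<bar> * a"
    using assms by (intro mult_right_mono) auto
  then have "2 * a \<le> \<bar>2 * of_int k * a\<bar>"
    using assms by (simp add: abs_mult)
  moreover have "\<bar>mirror a k s\<bar> = \<bar>s - 2 * of_int k * a\<bar>"
    by (simp add: mirror_def parity_def abs_mult)
  ultimately show ?thesis using assms by linarith
qed

text \<open>For flux through the faces normal to axis \<open>i\<close>, the image index of that axis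
  is summed innermost, where mirror pairs cancel; the two lateral indices form \<kappa>.\<close>

lemma sum_over_images:
  fixes F :: "real^3 \<Rightarrow> real"
  shows "(\<Sum>k\<in>images. \<Sum>l\<in>images. \<Sum>m\<in>images. parity k * parity l * parity m *
      F (vec3 (mirror a k (x $ 1), mirror a l (x $ 2), mirror a m (x $ 3))))
    = (\<Sum>\<kappa>\<in>images \<times> images. parity (fst \<kappa>) * parity (snd \<kappa>) *
        (\<Sum>k\<in>images. parity k * F (plane_point i (mirror a k (x $ i)) (mirror2 a \<kappa> (other_coords i x)))))"
proof -
  consider "i = 1" | "i = 2" | "i = 3" using exhaust_3 by blast
  then show ?thesis
  proof cases
    case 1
    have "(\<Sum>k\<in>images. \<Sum>l\<in>images. \<Sum>m\<in>images. parity k * parity l * parity m *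
      F (vec3 (mirror a k (x $ 1), mirror a l (x $ 2), mirror a m (x $ 3)))) =
      (\<Sum>l\<in>images. \<Sum>m\<in>images. \<Sum>k\<in>images. parity k * parity l * parity m *
      F (vec3 (mirror a k (x $ 1), mirror a l (x $ 2), mirror a m (x $ 3))))"
      by (rule trans [OF sum.swap]) (intro sum.cong refl sum.swap)
    with 1 show ?thesis
      by (simp add: sum.cartesian_product' sum_distrib_left other_coords_def mirror2_def plane_point_def vec3_def mult_ac)
  next
    case 2
    have "(\<Sum>k\<in>images. \<Sum>l\<in>images. \<Sum>m\<in>images. parity k * parity l * parity m *
      F (vec3 (mirror a k (x $ 1), mirror a l (x $ 2), mirror a m (x $ 3)))) =
      (\<Sum>k\<in>images. \<Sum>m\<in>images. \<Sum>l\<in>images. parity k * parity l * parity m *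
      F (vec3 (mirror a k (x $ 1), mirror a l (x $ 2), mirror a m (x $ 3))))"
      by (intro sum.cong refl sum.swap)
    with 2 show ?thesis
      by (simp add: sum.cartesian_product' sum_distrib_left other_coords_def mirror2_def plane_point_def vec3_def mult_ac)
  next
    case 3
    then show ?thesis
      by (simp add: sum.cartesian_product' sum_distrib_left other_coords_def mirror2_def plane_point_def vec3_def mult_ac)
  qed
qed

section \<open>Distances from face points to images, and vanishing of the wave\<close>

lemma norm_plane_point_diff:
  "(norm (plane_point i c \<eta> - plane_point i b \<zeta>))\<^sup>2 = (c - b)\<^sup>2 + (norm (\<eta> - \<zeta>))\<^sup>2"
  using exhaust_3 [of i]
  by (cases \<eta>; cases \<zeta>) (auto simp: norm_vec3 norm_Pair plane_point_def)

text \<open>The soft distance with the offset \<open>d\<close> along the normal separated from the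
  lateral coordinates \<zeta>, \<eta>: it is even in \<open>d\<close>, and for
  \<open>d \<noteq> 0\<close> it stays positive even at \<open>\<epsilon> = 0\<close>.\<close>

definition plane_dist :: "real \<Rightarrow> real \<Rightarrow> real \<times> real \<Rightarrow> real \<times> real \<Rightarrow> real" where
  "plane_dist \<epsilon> d \<zeta> \<eta> = sqrt (\<epsilon>\<^sup>2 + (d\<^sup>2 + (norm (\<eta> - \<zeta>))\<^sup>2))"

lemma plane_dist_minus: "plane_dist \<epsilon> (- d) \<zeta> \<eta> = plane_dist \<epsilon> d \<zeta> \<eta>"
  by (simp add: plane_dist_def)

lemma plane_dist_ge: "\<bar>d\<bar> \<le> plane_dist \<epsilon> d \<zeta> \<eta>"
  unfolding plane_dist_def by (rule real_le_rsqrt) simp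

lemma plane_dist_pos: "d \<noteq> 0 \<or> \<epsilon> \<noteq> 0 \<Longrightarrow> plane_dist \<epsilon> d \<zeta> \<eta> > 0"
proof -
  assume "d \<noteq> 0 \<or> \<epsilon> \<noteq> 0"
  then have "0 < \<epsilon>\<^sup>2 + d\<^sup>2"
    by (auto simp: sum_power2_gt_zero_iff)
  then have "0 < \<epsilon>\<^sup>2 + (d\<^sup>2 + (norm (\<eta> - \<zeta>))\<^sup>2)"
    using zero_le_power2 [of "norm (\<eta> - \<zeta>)"] by linarith
  then show ?thesis by (simp add: plane_dist_def)
qed

lemma continuous_on_plane_dist [continuous_intros]:
  assumes "continuous_on S e" "continuous_on S d" "continuous_on S \<eta>"
  shows "continuous_on S (\<lambda>x. plane_dist (e x) (d x) \<zeta> (\<eta> x))"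
  unfolding plane_dist_def by (intro continuous_intros assms)

locale cube_function = c2_function +
  fixes a :: real
  assumes a_pos: "a > 0"
    and support: "x \<notin> cube a \<Longrightarrow> f x = 0 \<and> f1 x = 0 \<and> f2 x = 0"
begin

text \<open>If both end points were in the closed cube, the second one in the open cube, every
  coordinate of the displacement would be below 2a in size, and its length below 2 sqrt 3 a.\<close>

lemma outside:
  assumes "\<And>i. \<bar>y $ i\<bar> \<le> a" "2 * sqrt 3 * a \<le> \<bar>t\<bar>" "norm \<omega> = 1"
  shows "y + t *\<^sub>R \<omega> \<notin> cube a"
proof
  assume "y + t *\<^sub>R \<omega> \<in> cube a"
  then have *: "\<bar>y $ i + t * \<omega> $ i\<bar> < a" for i
    by (simp add: cube_def)
  have "\<bar>t * \<omega> $ i\<bar> < \<bar>2 * a\<bar>" for i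
    using assms(1) [of i] * [of i] a_pos by linarith
  then have "(t * \<omega> $ i)\<^sup>2 < (2 * a)\<^sup>2" for i
    by (rule power2_strict_mono)
  from this [of 1] this [of 2] this [of 3]
  have "(t * \<omega> $ 1)\<^sup>2 + (t * \<omega> $ 2)\<^sup>2 + (t * \<omega> $ 3)\<^sup>2 < 12 * a\<^sup>2"
    by (simp add: power_mult_distrib)
  moreover have "(t * \<omega> $ 1)\<^sup>2 + (t * \<omega> $ 2)\<^sup>2 + (t * \<omega> $ 3)\<^sup>2 = t\<^sup>2 * (norm \<omega>)\<^sup>2"
    by (simp add: norm_vec3 power_mult_distrib distrib_left)
  moreover have "12 * a\<^sup>2 \<le> t\<^sup>2"
  proof -
    have "(2 * sqrt 3 * a)\<^sup>2 \<le> \<bar>t\<bar>\<^sup>2"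
      using assms(2) a_pos by (intro power_mono) auto
    then show ?thesis by (simp add: power_mult_distrib)
  qed
  ultimately show False using assms(3) by simp
qed

lemma V_vanish:
  assumes "\<And>i. \<bar>y $ i\<bar> \<le> a" "2 * sqrt 3 * a \<le> \<bar>t\<bar>"
  shows "V0 y t = 0" "V1 y t = 0" "V2 y t = 0" "V0d e y t = 0"
  using support [OF outside [OF assms]]
  by (auto simp: V0_def V1_def V2_def V0d_def blinfun.zero_left intro!: sphere_avg_zero)

text \<open>Fixes the constants of the image count: 4a - a/2 = 7a/2 exceeds 2 sqrt 3 a, since sqrt 3
  \<le> 7/4.\<close>

lemma far: "4 * a \<le> r \<Longrightarrow> \<bar>\<tau>\<bar> \<le> a / 2 \<Longrightarrow> 2 * sqrt 3 * a \<le> \<bar>\<tau> + r\<bar>"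
proof -
  assume *: "4 * a \<le> r" "\<bar>\<tau>\<bar> \<le> a / 2"
  have "sqrt 3 \<le> 7 / 4" by (rule real_le_lsqrt) (auto simp: power2_eq_square)
  then have "2 * sqrt 3 * a \<le> 7 / 2 * a" using a_pos by (intro mult_right_mono) auto
  with * show ?thesis by linarith
qed

definition face_point :: "3 \<Rightarrow> real \<Rightarrow> real \<times> real \<Rightarrow> real^3" where
  "face_point i \<sigma> \<eta> = plane_point i (\<sigma> * a) \<eta>"

text \<open>The radial coefficient of the field, the part that a mirror pair leaves, without the
  factor \<open>d\<close>. The data point stays on the face in \<sigma>a, but \<open>d\<close> is
  free, so that the planes \<sigma>a and -3\<sigma>a share one definition.\<close>

definition layer_density :: "3 \<Rightarrow> real \<Rightarrow> real \<Rightarrow> real \<Rightarrow> real \<times> real \<Rightarrow> real \<Rightarrow> real \<times> real \<Rightarrow> real" where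
  "layer_density i \<sigma> \<epsilon> d \<zeta> \<tau> \<eta> = (let r = plane_dist \<epsilon> d \<zeta> \<eta> in
     V0 (face_point i \<sigma> \<eta>) (\<tau> + r) / r ^ 3 - V1 (face_point i \<sigma> \<eta>) (\<tau> + r) / r ^ 2)"

lemma face_point_bound:
  assumes "\<eta> \<in> cbox (- a, - a) (a, a)" "\<sigma> \<in> {1, -1}"
  shows "\<bar>face_point i \<sigma> \<eta> $ j\<bar> \<le> a"
  using assms a_pos exhaust_3 [of i] exhaust_3 [of j]
  by (cases \<eta>) (auto simp: face_point_def plane_point_def cbox_Pair_eq abs_le_iff)

lemma pairing:
  assumes \<eta>: "\<eta> \<in> cbox (- a, - a) (a, a)" and \<sigma>: "\<sigma> \<in> {1, -1}" and \<tau>: "\<bar>\<tau>\<bar> \<le> a / 2" and s: "\<bar>s\<bar> < a"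
  shows "(\<Sum>k\<in>images. parity k * kirchhoff_field \<epsilon> (plane_point i (mirror a k s) \<zeta>) \<tau> i (face_point i \<sigma> \<eta>))
    = 2 * (\<Sum>c\<in>{\<sigma> * a, - 3 * \<sigma> * a}. (c - s) * layer_density i \<sigma> \<epsilon> (c - s) \<zeta> \<tau> \<eta>)"
proof -
  define \<Phi> where "\<Phi> d = (let r = plane_dist \<epsilon> d \<zeta> \<eta>; y = face_point i \<sigma> \<eta> in
     V0d (axis i 1) y (\<tau> + r) / r + d * (V0 y (\<tau> + r) / r ^ 3 - V1 y (\<tau> + r) / r ^ 2))" for d
  have field: "kirchhoff_field \<epsilon> (plane_point i b \<zeta>) \<tau> i (face_point i \<sigma> \<eta>) = \<Phi> (\<sigma> * a - b)" for b
    by (simp add: Let_def kirchhoff_field_def \<Phi>_def face_point_def soft_dist_def norm_plane_point_diff plane_dist_def)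
  have odd: "\<Phi> d - \<Phi> (- d) = 2 * (d * layer_density i \<sigma> \<epsilon> d \<zeta> \<tau> \<eta>)" for d
    by (simp add: \<Phi>_def Let_def plane_dist_minus layer_density_def algebra_simps)
  have far: "\<Phi> d = 0" if "4 * a \<le> \<bar>d\<bar>" for d
  proof -
    have "4 * a \<le> plane_dist \<epsilon> d \<zeta> \<eta>"
      using that plane_dist_ge [of d \<epsilon> \<zeta> \<eta>] by linarith
    from V_vanish [OF face_point_bound [OF \<eta> \<sigma>] far [OF this \<tau>]]
    show ?thesis by (simp add: \<Phi>_def Let_def)
  qed
  have ne: "\<sigma> * a \<noteq> - 3 * \<sigma> * a" using \<sigma> a_pos by auto
  \<comment> \<open>The mirror pairs are the indices 0, \<sigma> with offsets \<plusminus>(\<sigma>a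
    - s), and -2\<sigma>, -\<sigma> with offsets \<plusminus>(-3\<sigma>a - s). Index 2\<sigma>,
    whose partner 3\<sigma> is absent, has offset 5\<sigma>a - s, beyond 4a in size.\<close>
  have "(\<Sum>k\<in>images. parity k * \<Phi> (\<sigma> * a - mirror a k s)) =
      (\<Phi> (\<sigma> * a - s) - \<Phi> (- (\<sigma> * a - s))) + (\<Phi> (- 3 * \<sigma> * a - s) - \<Phi> (- (- 3 * \<sigma> * a - s)))"
    using \<sigma>
  proof
    assume 1: "\<sigma> = 1"
    have "\<Phi> (5 * a - s) = 0" using s by (intro far) linarith
    with 1 show ?thesis
      by (simp add: sum_images parity_def mirror_def algebra_simps)
  next
    assume "\<sigma> \<in> {-1}"
    then have 1: "\<sigma> = -1" by simp
    have "\<Phi> (- s - a * 5) = 0" using s by (intro far) linarith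
    with 1 show ?thesis
      by (simp add: sum_images parity_def mirror_def algebra_simps)
  qed
  then show ?thesis
    unfolding field odd using ne by (simp add: distrib_left)
qed

lemma continuous_on_layer_density:
  fixes e :: "'z::t2_space \<Rightarrow> real"
  assumes "continuous_on S e" "continuous_on S \<tau>" "continuous_on S \<eta>" "\<And>x. x \<in> S \<Longrightarrow> d \<noteq> 0 \<or> e x \<noteq> 0"
  shows "continuous_on S (\<lambda>x. layer_density i \<sigma> (e x) d \<zeta> (\<tau> x) (\<eta> x))"
  unfolding layer_density_def Let_def face_point_def
  by (intro continuous_intros assms) (use plane_dist_pos assms(4) in \<open>auto simp: less_le\<close>)

lemma continuous_on_kirchhoff_field: "\<epsilon> > 0 \<Longrightarrow> continuous_on UNIV (kirchhoff_field \<epsilon> p \<tau> i)"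
  unfolding kirchhoff_field_def [abs_def] Let_def
  by (intro continuous_intros) (use soft_dist_pos [of \<epsilon> p] in \<open>auto simp: less_le\<close>)

lemma face_integrable: "continuous_on UNIV g \<Longrightarrow> (g :: real \<times> real \<Rightarrow> real) integrable_on cbox (- a, - a) (a, a)"
  by (intro integrable_continuous) (rule continuous_on_subset, auto)

lemma image_flux:
  assumes "\<epsilon> > 0" and \<tau>: "\<bar>\<tau>\<bar> \<le> a / 2" and s: "\<bar>s\<bar> < a"
  shows "(\<Sum>k\<in>images. parity k * face_integral a (\<lambda>\<eta>.
       kirchhoff_field \<epsilon> (plane_point i (mirror a k s) \<zeta>) \<tau> i (plane_point i a \<eta>)
       - kirchhoff_field \<epsilon> (plane_point i (mirror a k s) \<zeta>) \<tau> i (plane_point i (- a) \<eta>)))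
    = 2 * (\<Sum>\<sigma>\<in>{1, -1}. \<sigma> * (\<Sum>c\<in>{\<sigma> * a, - 3 * \<sigma> * a}.
        (c - s) * face_integral a (layer_density i \<sigma> \<epsilon> (c - s) \<zeta> \<tau>)))"
proof -
  let ?Q = "cbox (- a, - a) (a, a)"
  let ?W = "\<lambda>k \<sigma> \<eta>. kirchhoff_field \<epsilon> (plane_point i (mirror a k s) \<zeta>) \<tau> i (face_point i \<sigma> \<eta>)"
  let ?L = "\<lambda>\<sigma> c. layer_density i \<sigma> \<epsilon> (c - s) \<zeta> \<tau>"
  have cW: "continuous_on UNIV (?W k \<sigma>)" for k \<sigma>
    unfolding face_point_def
    by (rule continuous_on_compose2 [OF continuous_on_kirchhoff_field [OF assms(1)]])
      (auto intro!: continuous_intros)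
  have cL: "continuous_on UNIV (?L \<sigma> c)" for \<sigma> c
    by (rule continuous_on_layer_density) (use assms(1) in \<open>auto intro!: continuous_intros\<close>)
  have "(\<Sum>k\<in>images. parity k * face_integral a (\<lambda>\<eta>. ?W k 1 \<eta> - ?W k (-1) \<eta>)) =
      integral ?Q (\<lambda>\<eta>. \<Sum>k\<in>images. parity k * (?W k 1 \<eta> - ?W k (-1) \<eta>))"
    unfolding face_integral_def
    by (subst integral_sum) (auto intro!: face_integrable continuous_intros cW)
  also have "\<dots> = integral ?Q (\<lambda>\<eta>. (\<Sum>\<sigma>\<in>{1, -1}. \<Sum>c\<in>{\<sigma> * a, - 3 * \<sigma> * a}. 2 * \<sigma> * (c - s) * ?L \<sigma> c \<eta>))"
  proof (rule Henstock_Kurzweil_Integration.integral_cong)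
    fix \<eta> assume \<eta>: "\<eta> \<in> ?Q"
    have "(\<Sum>k\<in>images. parity k * (?W k 1 \<eta> - ?W k (-1) \<eta>)) =
       (\<Sum>k\<in>images. parity k * ?W k 1 \<eta>) - (\<Sum>k\<in>images. parity k * ?W k (-1) \<eta>)"
      by (simp add: right_diff_distrib sum_subtractf)
    also have "\<dots> = (\<Sum>\<sigma>\<in>{1, -1}. \<Sum>c\<in>{\<sigma> * a, - 3 * \<sigma> * a}. 2 * \<sigma> * (c - s) * ?L \<sigma> c \<eta>)"
      by (simp add: pairing [OF \<eta> _ \<tau> s] sum_distrib_left mult.assoc del: sum.insert) (simp add: sum_negf)
    finally show "(\<Sum>k\<in>images. parity k * (?W k 1 \<eta> - ?W k (-1) \<eta>)) =
       (\<Sum>\<sigma>\<in>{1, -1}. \<Sum>c\<in>{\<sigma> * a, - 3 * \<sigma> * a}. 2 * \<sigma> * (c - s) * ?L \<sigma> c \<eta>)" .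
  qed
  also have "\<dots> = (\<Sum>\<sigma>\<in>{1, -1}. integral ?Q (\<lambda>\<eta>. \<Sum>c\<in>{\<sigma> * a, - 3 * \<sigma> * a}. 2 * \<sigma> * (c - s) * ?L \<sigma> c \<eta>))"
    by (rule integral_sum) (auto intro!: face_integrable continuous_intros cL)
  also have "\<dots> = (\<Sum>\<sigma>\<in>{1, -1}. \<Sum>c\<in>{\<sigma> * a, - 3 * \<sigma> * a}. integral ?Q (\<lambda>\<eta>. 2 * \<sigma> * (c - s) * ?L \<sigma> c \<eta>))"
    by (intro sum.cong refl integral_sum) (auto intro!: face_integrable continuous_intros cL)
  also have "\<dots> = 2 * (\<Sum>\<sigma>\<in>{1, -1}. \<sigma> * (\<Sum>c\<in>{\<sigma> * a, - 3 * \<sigma> * a}. (c - s) * face_integral a (?L \<sigma> c)))"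
    unfolding face_integral_def sum_distrib_left by (intro sum.cong refl) (simp add: mult.assoc)
  finally show ?thesis by (simp add: face_point_def)
qed

text \<open>The summand is a parameter because the same signed sum serves for the flux densities,
  for their \<tau>-derivatives and for the potentials.\<close>

definition layer_sum :: "real^3 \<Rightarrow> 3 \<Rightarrow> (3 \<Rightarrow> real \<Rightarrow> real \<Rightarrow> real \<times> real \<Rightarrow> real) \<Rightarrow> real" where
  "layer_sum x i L = (\<Sum>\<kappa>\<in>images \<times> images. parity (fst \<kappa>) * parity (snd \<kappa>) *
     (\<Sum>\<sigma>\<in>{1, -1}. \<sigma> * (\<Sum>c\<in>{\<sigma> * a, - 3 * \<sigma> * a}. L i \<sigma> (c - x $ i) (mirror2 a \<kappa> (other_coords i x)))))"

lemma kirchhoff_images: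
  assumes "\<epsilon> > 0" and \<tau>: "\<bar>\<tau>\<bar> \<le> a / 2" and x: "x \<in> cube a"
  shows "(\<Sum>k\<in>images. \<Sum>l\<in>images. \<Sum>m\<in>images. parity k * parity l * parity m *
      box_integral a (kirchhoff_source \<epsilon> (vec3 (mirror a k (x $ 1), mirror a l (x $ 2), mirror a m (x $ 3))) \<tau>))
    = 2 * (\<Sum>i\<in>UNIV. layer_sum x i (\<lambda>i \<sigma> d \<zeta>. d * face_integral a (layer_density i \<sigma> \<epsilon> d \<zeta> \<tau>)))"
proof -
  define F where "F i p = face_integral a (\<lambda>\<eta>. kirchhoff_field \<epsilon> p \<tau> i (plane_point i a \<eta>)
      - kirchhoff_field \<epsilon> p \<tau> i (plane_point i (- a) \<eta>))" for i p
  have s: "\<bar>x $ i\<bar> < a" for i using x by (simp add: cube_def)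
  have "(\<Sum>k\<in>images. \<Sum>l\<in>images. \<Sum>m\<in>images. parity k * parity l * parity m *
      box_integral a (kirchhoff_source \<epsilon> (vec3 (mirror a k (x $ 1), mirror a l (x $ 2), mirror a m (x $ 3))) \<tau>))
    = (\<Sum>i\<in>UNIV. \<Sum>k\<in>images. \<Sum>l\<in>images. \<Sum>m\<in>images. parity k * parity l * parity m *
      F i (vec3 (mirror a k (x $ 1), mirror a l (x $ 2), mirror a m (x $ 3))))"
    unfolding kirchhoff_flux [OF assms(1) less_imp_le [OF a_pos], symmetric] F_def [symmetric]
    by (simp add: sum_3 sum.distrib distrib_left)
  also have "\<dots> = (\<Sum>i\<in>UNIV. \<Sum>\<kappa>\<in>images \<times> images. parity (fst \<kappa>) * parity (snd \<kappa>) *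
        (\<Sum>k\<in>images. parity k * F i (plane_point i (mirror a k (x $ i)) (mirror2 a \<kappa> (other_coords i x)))))"
    by (intro sum.cong refl sum_over_images)
  also have "\<dots> = 2 * (\<Sum>i\<in>UNIV. layer_sum x i (\<lambda>i \<sigma> d \<zeta>. d * face_integral a (layer_density i \<sigma> \<epsilon> d \<zeta> \<tau>)))"
    unfolding F_def image_flux [OF assms(1) \<tau> s] layer_sum_def
    by (simp only: sum_distrib_left mult_ac)
  finally show ?thesis .
qed

text \<open>The limit \<epsilon> to 0 of \<open>kirchhoff_images\<close>. The sources of all
  nontrivial images disappear and the trivial one leaves 4 pi / 3 times 3 u; on the other side the
  offsets are nonzero, so the layers converge without singularity.\<close>

lemma kirchhoff_faces:
  assumes \<tau>: "\<bar>\<tau>\<bar> \<le> a / 2" and x: "x \<in> cube a"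
  shows "2 * pi * V0 x \<tau> =
    (\<Sum>i\<in>UNIV. layer_sum x i (\<lambda>i \<sigma> d \<zeta>. d * face_integral a (layer_density i \<sigma> 0 d \<zeta> \<tau>)))"
proof -
  define e where "e n = inverse (real (Suc n))" for n
  have e: "e \<longlonglongrightarrow> 0" "\<And>n. 0 < e n" "\<And>n. e n \<le> 1"
    unfolding e_def using LIMSEQ_inverse_real_of_nat by (auto simp: field_simps)
  have s: "\<bar>x $ i\<bar> < a" for i using x by (simp add: cube_def)
  define H where "H y s = 3 * V0 y (\<tau> + s) - 3 * s * V1 y (\<tau> + s) + s\<^sup>2 * V2 y (\<tau> + s)" for y s
  have H: "continuous_on UNIV (\<lambda>(y, s). H y s)"
    unfolding H_def case_prod_unfold by (intro continuous_intros)
  define P where "P k l m = (mirror a k (x $ 1), mirror a l (x $ 2), mirror a m (x $ 3))" for k l m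
  have mirror0: "mirror a 0 u = u" for u by (simp add: mirror_def parity_def)
  \<comment> \<open>Both facts needed for \<open>concentration\<close>: which image is interior, and
    that none lies on the boundary.\<close>
  have inbox: "P k l m \<in> box (- a, - a, - a) (a, a, a) \<longleftrightarrow> k = 0 \<and> l = 0 \<and> m = 0"
    and "P k l m \<in> box (- a, - a, - a) (a, a, a) \<or> P k l m \<notin> cbox (- a, - a, - a) (a, a, a)" for k l m
    using mirror_outside [OF s, of k 1] mirror_outside [OF s, of l 2] mirror_outside [OF s, of m 3]
      s [of 1] s [of 2] s [of 3]
    by (cases "k = 0"; cases "l = 0"; cases "m = 0";
      auto simp: P_def mirror0 mem_box Basis_prod_def abs_less_iff abs_le_iff)+
  note conc = concentration [OF H this(2) e]
  have src: "kirchhoff_source \<epsilon> p \<tau> = (\<lambda>y. \<epsilon>\<^sup>2 * H y (soft_dist \<epsilon> p y) / soft_dist \<epsilon> p y ^ 5)" for \<epsilon> p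
    by (simp add: kirchhoff_source_def H_def Let_def fun_eq_iff)
  have "(\<lambda>n. \<Sum>k\<in>images. \<Sum>l\<in>images. \<Sum>m\<in>images. parity k * parity l * parity m *
      box_integral a (kirchhoff_source (e n) (vec3 (P k l m)) \<tau>)) \<longlonglongrightarrow>
     (\<Sum>k\<in>images. \<Sum>l\<in>images. \<Sum>m\<in>images. parity k * parity l * parity m *
       (if P k l m \<in> box (- a, - a, - a) (a, a, a) then 4 * pi / 3 * H (vec3 (P k l m)) 0 else 0))"
    unfolding src by (intro tendsto_sum tendsto_mult_left conc)
  also have "(\<Sum>k\<in>images. \<Sum>l\<in>images. \<Sum>m\<in>images. parity k * parity l * parity m *
       (if P k l m \<in> box (- a, - a, - a) (a, a, a) then 4 * pi / 3 * H (vec3 (P k l m)) 0 else 0)) =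
     4 * pi / 3 * H (vec3 (P 0 0 0)) 0"
    unfolding inbox by (simp add: sum_images parity_def)
  also have "vec3 (P 0 0 0) = x"
    by (simp add: P_def mirror0 vec_eq_iff forall_3)
  finally have lim1: "(\<lambda>n. 2 * (\<Sum>i\<in>UNIV. layer_sum x i (\<lambda>i \<sigma> d \<zeta>. d * face_integral a (layer_density i \<sigma> (e n) d \<zeta> \<tau>))))
      \<longlonglongrightarrow> 4 * pi / 3 * H x 0"
    unfolding P_def kirchhoff_images [OF e(2) \<tau> x] .
  have ne: "c - x $ i \<noteq> 0" if "c \<in> {\<sigma> * a, - 3 * \<sigma> * a}" "\<sigma> \<in> {1, -1}" for c \<sigma> i
    using that s [of i] by auto
  have lim2: "(\<lambda>n. face_integral a (layer_density i \<sigma> (e n) d \<zeta> \<tau>)) \<longlonglongrightarrow> face_integral a (layer_density i \<sigma> 0 d \<zeta> \<tau>)"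
    if "d \<noteq> 0" for i \<sigma> d \<zeta>
  proof -
    have "continuous_on UNIV (\<lambda>\<epsilon>. face_integral a (layer_density i \<sigma> \<epsilon> d \<zeta> \<tau>))"
      unfolding face_integral_def
      by (intro integral_continuous_on_param)
        (auto simp: case_prod_unfold that intro!: continuous_on_layer_density continuous_intros)
    then show ?thesis
      using e(1) by (auto simp: continuous_on_eq_continuous_at intro: isCont_tendsto_compose)
  qed
  have "(\<lambda>n. 2 * (\<Sum>i\<in>UNIV. layer_sum x i (\<lambda>i \<sigma> d \<zeta>. d * face_integral a (layer_density i \<sigma> (e n) d \<zeta> \<tau>))))
      \<longlonglongrightarrow> 2 * (\<Sum>i\<in>UNIV. layer_sum x i (\<lambda>i \<sigma> d \<zeta>. d * face_integral a (layer_density i \<sigma> 0 d \<zeta> \<tau>)))"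
    unfolding layer_sum_def by (intro tendsto_sum tendsto_mult_left lim2 ne)
  from LIMSEQ_unique [OF lim1 this] show ?thesis
    by (simp add: H_def)
qed

end

section \<open>Differentiating the layers\<close>

lemma parity_power: "(-1) powi k = parity k"
  by (simp add: parity_def power_int_minus_left)

lemma abs_mirror: "\<bar>mirror a k s\<bar> = \<bar>s - 2 * of_int k * a\<bar>"
  by (simp add: mirror_def parity_def abs_mult)

lemma distr_mirror: "distr lborel borel (mirror a k) = lborel"
proof -
  have "lborel = density (distr lborel borel (\<lambda>s. - (parity k * (2 * of_int k * a)) + parity k * s))
      (\<lambda>_. ennreal \<bar>parity k\<bar>)"
    by (rule lborel_real_affine) (simp add: parity_def)
  also have "(\<lambda>s. - (parity k * (2 * of_int k * a)) + parity k * s) = mirror a k"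
    by (simp add: mirror_def fun_eq_iff algebra_simps)
  also have "\<bar>parity k\<bar> = 1" by (simp add: parity_def)
  finally show ?thesis by (simp add: density_1)
qed

lemma continuous_on_mirror2 [continuous_intros]:
  "continuous_on S g \<Longrightarrow> continuous_on S (\<lambda>x. mirror2 a \<kappa> (g x))"
  unfolding mirror2_def mirror_def by (intro continuous_intros)

lemma mirror2_measurable [measurable]: "mirror2 a \<kappa> \<in> borel_measurable borel"
  by (intro borel_measurable_continuous_onI continuous_intros)

lemma distr_mirror2: "distr lborel borel (mirror2 a \<kappa>) = lborel"
proof -
  have [measurable]: "mirror a k \<in> borel_measurable borel" for k
    unfolding mirror_def by (intro borel_measurable_continuous_onI continuous_intros)
  have "lborel = distr lborel borel (mirror a (fst \<kappa>)) \<Otimes>\<^sub>M distr lborel borel (mirror a (snd \<kappa>))"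
    by (simp add: distr_mirror lborel_prod)
  also have "\<dots> = distr (lborel \<Otimes>\<^sub>M lborel) (borel \<Otimes>\<^sub>M borel) (\<lambda>(x, y). (mirror a (fst \<kappa>) x, mirror a (snd \<kappa>) y))"
    by (rule pair_measure_distr) (auto simp: distr_mirror intro: sigma_finite_lborel)
  finally show ?thesis
    by (simp add: lborel_prod borel_prod mirror2_def [abs_def] case_prod_unfold)
qed

lemma norm_mirror2_diff: "norm (mirror2 a \<kappa> \<xi> - mirror2 a \<kappa> \<zeta>) = norm (\<xi> - \<zeta>)"
proof -
  have "(mirror a k s - mirror a k t)\<^sup>2 = (s - t)\<^sup>2" for k s t
    by (simp add: mirror_def parity_def power2_eq_square algebra_simps)
  then show ?thesis by (cases \<xi>; cases \<zeta>) (simp add: mirror2_def norm_Pair)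
qed

context cube_function
begin

definition layer_deriv :: "3 \<Rightarrow> real \<Rightarrow> real \<Rightarrow> real \<times> real \<Rightarrow> real \<times> real \<Rightarrow> real" where
  "layer_deriv i \<sigma> d \<zeta> \<eta> = (let r = plane_dist 0 d \<zeta> \<eta> in
     V1 (face_point i \<sigma> \<eta>) r / r ^ 3 - V2 (face_point i \<sigma> \<eta>) r / r ^ 2)"

text \<open>Since \<open>V1\<close> is the time derivative of t M, this is the kernel (1/t)
  \<partial>_t(t M) at t = r, before replication.\<close>

definition potential_density :: "3 \<Rightarrow> real \<Rightarrow> real \<Rightarrow> real \<times> real \<Rightarrow> real \<times> real \<Rightarrow> real" where
  "potential_density i \<sigma> d \<zeta> \<eta> = (let r = plane_dist 0 d \<zeta> \<eta> in V1 (face_point i \<sigma> \<eta>) r / r)"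

lemma deriv_layer_density:
  assumes "d \<noteq> 0"
  shows "((\<lambda>\<tau>. face_integral a (layer_density i \<sigma> 0 d \<zeta> \<tau>)) has_real_derivative
    face_integral a (layer_deriv i \<sigma> d \<zeta>)) (at 0)"
proof -
  let ?r = "plane_dist 0 d \<zeta>" and ?y = "face_point i \<sigma>"
  define D where "D \<tau> \<eta> = V1 (?y \<eta>) (\<tau> + ?r \<eta>) / ?r \<eta> ^ 3 - V2 (?y \<eta>) (\<tau> + ?r \<eta>) / ?r \<eta> ^ 2" for \<tau> \<eta>
  have r: "?r \<eta> \<noteq> 0" for \<eta>
    using plane_dist_pos [of d 0 \<zeta> \<eta>] assms by simp
  have d0: "((\<lambda>\<tau>. V0 y (\<tau> + r)) has_real_derivative V1 y (\<tau> + r)) (at \<tau>)"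
    and d1: "((\<lambda>\<tau>. V1 y (\<tau> + r)) has_real_derivative V2 y (\<tau> + r)) (at \<tau>)" for y r \<tau>
    using V0_deriv [of y "\<tau> + r"] V1_deriv [of y "\<tau> + r"] by (simp_all add: DERIV_shift)
  have "((\<lambda>\<tau>. integral (cbox (- a, - a) (a, a)) (layer_density i \<sigma> 0 d \<zeta> \<tau>)) has_real_derivative
    integral (cbox (- a, - a) (a, a)) (D 0))
    (at 0 within UNIV)"
  proof (rule leibniz_rule_field_derivative)
    fix \<tau> \<eta>
    show "((\<lambda>\<tau>. layer_density i \<sigma> 0 d \<zeta> \<tau> \<eta>) has_real_derivative
      D \<tau> \<eta>) (at \<tau> within UNIV)"
      unfolding layer_density_def D_def Let_def by (intro DERIV_diff DERIV_cdivide d0 d1)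
  next
    show "layer_density i \<sigma> 0 d \<zeta> \<tau> integrable_on cbox (- a, - a) (a, a)" for \<tau>
      by (intro face_integrable continuous_on_layer_density) (use assms in \<open>auto intro!: continuous_intros\<close>)
    show "continuous_on (UNIV \<times> cbox (- a, - a) (a, a))
      (\<lambda>(\<tau>, \<eta>). D \<tau> \<eta>)"
      unfolding D_def case_prod_unfold face_point_def by (intro continuous_intros) (simp_all add: r)
  qed auto
  then show ?thesis
    by (simp add: face_integral_def layer_deriv_def [abs_def] D_def [abs_def] Let_def)
qed

text \<open>The chain rule with r' = d / r gives d V2 / r^2 - d V1 / r^3. This is the identity that
  turns the differentiated flux into a derivative of a potential.\<close>

lemma deriv_potential_density:
  assumes "d \<noteq> 0"
  shows "((\<lambda>d. face_integral a (potential_density i \<sigma> d \<zeta>)) has_real_derivative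
    - (d * face_integral a (layer_deriv i \<sigma> d \<zeta>))) (at d)"
proof -
  let ?r = "\<lambda>d \<eta>. plane_dist 0 d \<zeta> \<eta>" and ?y = "face_point i \<sigma>"
  define D where "D d \<eta> = (d / ?r d \<eta> * V2 (?y \<eta>) (?r d \<eta>) * ?r d \<eta> - V1 (?y \<eta>) (?r d \<eta>) * (d / ?r d \<eta>))
      / (?r d \<eta> * ?r d \<eta>)" for d \<eta>
  \<comment> \<open>A neighbourhood of \<open>d\<close> that avoids 0, so that the distance never
    vanishes on it.\<close>
  let ?U = "ball d \<bar>d\<bar>"
  have U: "d' \<noteq> 0" if "d' \<in> ?U" for d' using that by (auto simp: dist_real_def)
  have r: "?r d' \<eta> \<noteq> 0" if "d' \<in> ?U" for d' \<eta>
    using plane_dist_pos [of d' 0 \<zeta> \<eta>] U [OF that] by simp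
  have "((\<lambda>d. integral (cbox (- a, - a) (a, a)) (potential_density i \<sigma> d \<zeta>)) has_real_derivative
    integral (cbox (- a, - a) (a, a)) (D d)) (at d within ?U)"
  proof (rule leibniz_rule_field_derivative)
    fix d' \<eta> assume d': "d' \<in> ?U"
    have pos: "0 < d'\<^sup>2 + (norm (\<eta> - \<zeta>))\<^sup>2"
      using U [OF d'] by (intro add_pos_nonneg) auto
    have "((\<lambda>d. d\<^sup>2 + (norm (\<eta> - \<zeta>))\<^sup>2) has_real_derivative 2 * d') (at d')"
      by (auto intro!: derivative_eq_intros)
    from DERIV_chain2 [where g = "\<lambda>d. d\<^sup>2 + (norm (\<eta> - \<zeta>))\<^sup>2", OF DERIV_real_sqrt [OF pos] this]
    have dr: "((\<lambda>d. ?r d \<eta>) has_real_derivative d' / ?r d' \<eta>) (at d')"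
      by (simp add: plane_dist_def inverse_eq_divide)
    show "((\<lambda>d. potential_density i \<sigma> d \<zeta> \<eta>) has_real_derivative D d' \<eta>) (at d' within ?U)"
      unfolding potential_density_def D_def Let_def
      by (rule has_field_derivative_at_within, rule DERIV_cong
          [OF DERIV_divide [OF DERIV_chain2 [OF V1_deriv dr] dr]]) (use r [OF d'] in \<open>auto simp: mult_ac\<close>)
  next
    show "potential_density i \<sigma> d' \<zeta> integrable_on cbox (- a, - a) (a, a)" if "d' \<in> ?U" for d'
      unfolding potential_density_def [abs_def] Let_def face_point_def
      by (intro face_integrable continuous_intros) (simp add: r [OF that])
    show "continuous_on (?U \<times> cbox (- a, - a) (a, a)) (\<lambda>(d, \<eta>). D d \<eta>)"
      unfolding D_def case_prod_unfold face_point_def by (intro continuous_intros) (auto simp: r)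
  qed (use assms in auto)
  then have "((\<lambda>d. integral (cbox (- a, - a) (a, a)) (potential_density i \<sigma> d \<zeta>)) has_real_derivative
    integral (cbox (- a, - a) (a, a)) (D d)) (at d)"
    using assms by (simp add: at_within_open [of d ?U])
  moreover have "D d \<eta> = - d * layer_deriv i \<sigma> d \<zeta> \<eta>" for \<eta>
    using plane_dist_pos [of d 0 \<zeta> \<eta>] assms
    by (simp add: D_def layer_deriv_def Let_def field_simps eval_nat_numeral)
  then have "D d = (\<lambda>\<eta>. - d * layer_deriv i \<sigma> d \<zeta> \<eta>)" by blast
  ultimately show ?thesis by (simp add: face_integral_def)
qed

lemma offset_nonzero:
  assumes "x \<in> cube a" "c \<in> {\<sigma> * a, - 3 * \<sigma> * a}" "\<sigma> \<in> {1, -1}"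
  shows "c - x $ i \<noteq> 0"
proof -
  have "\<bar>x $ i\<bar> < a" using assms(1) by (simp add: cube_def)
  then show ?thesis using assms by auto
qed

text \<open>The wave starts at 0 with velocity \<open>f\<close>, so its \<tau>-derivative at 0 is
  \<open>f x\<close>. The identity being differentiated is known only for small \<bar>\<tau>\<bar>,
  which suffices.\<close>

lemma inversion_layers:
  assumes x: "x \<in> cube a"
  shows "2 * pi * f x = (\<Sum>i\<in>UNIV. layer_sum x i (\<lambda>i \<sigma> d \<zeta>. d * face_integral a (layer_deriv i \<sigma> d \<zeta>)))"
proof (rule DERIV_unique)
  show "((\<lambda>\<tau>. 2 * pi * V0 x \<tau>) has_real_derivative 2 * pi * f x) (at 0)"
    using V0_deriv [of x 0] unfolding V1_0 by (rule DERIV_cmult)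
  have "((\<lambda>\<tau>. \<Sum>i\<in>UNIV. layer_sum x i (\<lambda>i \<sigma> d \<zeta>. d * face_integral a (layer_density i \<sigma> 0 d \<zeta> \<tau>)))
      has_real_derivative (\<Sum>i\<in>UNIV. layer_sum x i (\<lambda>i \<sigma> d \<zeta>. d * face_integral a (layer_deriv i \<sigma> d \<zeta>)))) (at 0)"
    unfolding layer_sum_def
    by (intro DERIV_sum DERIV_cmult deriv_layer_density offset_nonzero [OF x])
  then show "((\<lambda>\<tau>. 2 * pi * V0 x \<tau>) has_real_derivative
      (\<Sum>i\<in>UNIV. layer_sum x i (\<lambda>i \<sigma> d \<zeta>. d * face_integral a (layer_deriv i \<sigma> d \<zeta>)))) (at 0)"
    by (rule has_field_derivative_transform_within_open [where S = "ball 0 (a / 2)"])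
      (use a_pos in \<open>auto simp: kirchhoff_faces [OF _ x]\<close>)
qed

text \<open>Moving \<open>x\<close> along axis \<open>i\<close> changes only the offsets c - x_i and
  leaves all lateral images in place; the inner derivative -1 cancels the sign in
  \<open>deriv_potential_density\<close>.\<close>

lemma deriv_layer_potential:
  assumes x: "x \<in> cube a"
  shows "((\<lambda>s. layer_sum (x + s *\<^sub>R axis i 1) i (\<lambda>i \<sigma> d \<zeta>. face_integral a (potential_density i \<sigma> d \<zeta>)))
    has_real_derivative layer_sum x i (\<lambda>i \<sigma> d \<zeta>. d * face_integral a (layer_deriv i \<sigma> d \<zeta>))) (at 0)"
proof -
  have oc: "other_coords i (x + s *\<^sub>R axis i 1) = other_coords i x" for s
    using exhaust_3 [of i] by (auto simp: other_coords_def axis_def)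
  have dl: "((\<lambda>s. face_integral a (potential_density i \<sigma> (c - (x $ i + s)) \<zeta>)) has_real_derivative
      (c - x $ i) * face_integral a (layer_deriv i \<sigma> (c - x $ i) \<zeta>)) (at 0)"
    if "c - x $ i \<noteq> 0" for c \<sigma> \<zeta>
  proof -
    have d: "((\<lambda>s. c - (x $ i + s)) has_real_derivative - 1) (at 0)"
      by (auto intro!: derivative_eq_intros)
    have "((\<lambda>d. face_integral a (potential_density i \<sigma> d \<zeta>)) has_real_derivative
      - ((c - x $ i) * face_integral a (layer_deriv i \<sigma> (c - x $ i) \<zeta>))) (at (c - (x $ i + 0)))"
      using deriv_potential_density [OF that] by simp
    from DERIV_chain2 [where g = "\<lambda>s. c - (x $ i + s)", OF this d] show ?thesis by simp
  qed
  show ?thesis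
    unfolding layer_sum_def oc
    by (simp only: vector_add_component vector_scaleR_component axis_nth mult_1_right real_scaleR_def)
      (intro DERIV_sum DERIV_cmult dl offset_nonzero [OF x])
qed

end

section \<open>Unfolding the replicated means\<close>

lemma open_cube: "open (cube a)"
proof -
  have "cube a = (\<Inter>i. {x. \<bar>x $ i\<bar> < a})" by (auto simp: cube_def)
  moreover have "open {x :: real^3. \<bar>x $ i\<bar> < a}" for i
    by (intro open_Collect_less continuous_intros)
  ultimately show ?thesis by (simp add: open_INT)
qed

text \<open>\<open>C2_on\<close> says nothing about its witnesses off the cube, so they are
  redefined as 0 there. The cube and the complement of the support are open and cover the space, and
  all properties are glued from these two sets.\<close>

lemma C2_compact_support_extend:
  assumes "C2_compact_support f (cube a)"
  obtains f1 f2 where "\<And>x. (f has_derivative blinfun_apply (f1 x)) (at x)"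
    "\<And>x. (f1 has_derivative blinfun_apply (f2 x)) (at x)"
    "continuous_on UNIV f2" "\<And>x. x \<notin> cube a \<Longrightarrow> f x = 0 \<and> f1 x = 0 \<and> f2 x = 0"
proof -
  define N where "N = - closure {x. f x \<noteq> 0}"
  have N: "open N" "\<And>x. x \<in> N \<Longrightarrow> f x = 0"
    using closure_subset [of "{x. f x \<noteq> 0}"] by (auto simp: N_def)
  from assms have cover: "cube a \<union> N = UNIV"
    by (auto simp: C2_compact_support_def N_def)
  from assms obtain g1 g2 where g1: "\<And>x. x \<in> cube a \<Longrightarrow> (f has_derivative blinfun_apply (g1 x)) (at x)"
    and g2: "\<And>x. x \<in> cube a \<Longrightarrow> (g1 has_derivative blinfun_apply (g2 x)) (at x)"
    and c: "continuous_on (cube a) g2"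
    unfolding C2_compact_support_def C2_on_def by blast
  define f1 where "f1 x = (if x \<in> cube a then g1 x else 0)" for x
  define f2 where "f2 x = (if x \<in> cube a then g2 x else 0)" for x
  have fN: "(f has_derivative (\<lambda>_. 0)) (at x)" if "x \<in> N" for x
    by (rule has_derivative_transform_within_open [OF has_derivative_const N(1) that]) (simp add: N(2))
  \<comment> \<open>On the overlap \<open>f\<close> is locally 0, and uniqueness of derivatives
    forces the given derivative to agree with the extension by zero.\<close>
  have f1N: "f1 x = 0" if "x \<in> N" for x
    using has_derivative_unique [OF g1 fN [OF that]]
    by (auto simp: f1_def intro!: blinfun_eqI)
  have f1d: "(f1 has_derivative blinfun_apply (f2 x)) (at x)" if "x \<in> cube a" for x
  proof -
    have "(g1 has_derivative blinfun_apply (f2 x)) (at x)" using g2 that by (simp add: f2_def)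
    then show ?thesis
      by (rule has_derivative_transform_within_open [OF _ open_cube that]) (simp add: f1_def)
  qed
  have f1dN: "(f1 has_derivative (\<lambda>_. 0)) (at x)" if "x \<in> N" for x
    by (rule has_derivative_transform_within_open [OF has_derivative_const N(1) that]) (simp add: f1N)
  have f2N: "f2 x = 0" if "x \<in> N" for x
  proof (cases "x \<in> cube a")
    case True
    then show ?thesis
      using has_derivative_unique [OF f1d f1dN [OF that]] by (auto intro!: blinfun_eqI)
  qed (simp add: f2_def)
  show ?thesis
  proof
    fix x
    have x: "x \<in> cube a \<or> x \<in> N" using cover by auto
    then show "(f has_derivative blinfun_apply (f1 x)) (at x)"
      using g1 fN f1N by (auto simp: f1_def zero_blinfun.rep_eq split: if_splits)
    show "(f1 has_derivative blinfun_apply (f2 x)) (at x)"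
      using x f1d f1dN f2N by (auto simp: zero_blinfun.rep_eq)
    show "f x = 0 \<and> f1 x = 0 \<and> f2 x = 0" if "x \<notin> cube a"
      using that x N(2) by (auto simp: f1_def f2_def)
  next
    have "continuous_on (cube a) f2" using c by (simp add: f2_def cong: continuous_on_cong)
    moreover have "continuous_on N f2"
      using f2N by (simp cong: continuous_on_cong)
    ultimately show "continuous_on UNIV f2"
      using continuous_on_open_Un [OF open_cube N(1)] cover by metis
  qed
qed

section \<open>Squares of the replication and their folding onto the face\<close>

lemma mem_square: "mirror2 a (n, m) (u, v) \<in> box (- a, - a) (a, a) \<longleftrightarrow>
    \<bar>u - 2 * of_int n * a\<bar> < a \<and> \<bar>v - 2 * of_int m * a\<bar> < a"
  unfolding abs_mirror [of a, symmetric]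
  by (auto simp: mirror2_def mem_box Basis_prod_def abs_less_iff)

lemma E2D_mirror2:
  assumes "a > 0" "mirror2 a \<kappa> \<xi> \<in> box (- a, - a) (a, a)"
  shows "E2D a h \<xi> = parity (fst \<kappa>) * parity (snd \<kappa>) * h (mirror2 a \<kappa> \<xi>)"
proof -
  obtain n m u v where [simp]: "\<kappa> = (n, m)" "\<xi> = (u, v)" by (cases \<kappa>; cases \<xi>)
  have "\<bar>u - 2 * of_int n * a\<bar> < a" "\<bar>v - 2 * of_int m * a\<bar> < a"
    using assms(2) by (simp_all add: mem_square)
  moreover have "parity (m + n) = parity n * parity m" by (simp add: parity_def)
  ultimately show ?thesis
    using E2D_square [of a u n v m h] \<open>a > 0\<close> by (simp add: parity_power mirror2_def mirror_def)
qed

lemma E2D_no_square: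
  assumes "\<nexists>\<kappa>. mirror2 a \<kappa> \<xi> \<in> box (- a, - a) (a, a)"
  shows "E2D a h \<xi> = 0"
proof (cases \<xi>)
  case (Pair u v)
  with assms have "\<not> (\<exists>n m :: int. \<bar>u - 2 * of_int n * a\<bar> < a \<and> \<bar>v - 2 * of_int m * a\<bar> < a)"
    by (auto simp: mem_square [symmetric])
  then show ?thesis using E2D_outside_squares Pair by blast
qed

lemma square_unique:
  assumes "a > 0" "mirror2 a \<kappa> \<xi> \<in> box (- a, - a) (a, a)" "mirror2 a \<kappa>' \<xi> \<in> box (- a, - a) (a, a)"
  shows "\<kappa> = \<kappa>'"
  using assms by (cases \<kappa>; cases \<kappa>'; cases \<xi>) (auto simp: mem_square dest!: square_index [rotated])

text \<open>Folding a square onto the face preserves Lebesgue measure, and passing from the closed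
  to the open square drops only a null set.\<close>

lemma square_integral:
  fixes g :: "real \<times> real \<Rightarrow> real"
  assumes g: "continuous_on UNIV g"
  shows "integrable lborel (\<lambda>\<xi>. indicator (box (- a, - a) (a, a)) (mirror2 a \<kappa> \<xi>) * g (mirror2 a \<kappa> \<xi>))"
    and "(LINT \<xi>|lborel. indicator (box (- a, - a) (a, a)) (mirror2 a \<kappa> \<xi>) * g (mirror2 a \<kappa> \<xi>)) = face_integral a g"
proof -
  let ?B = "box (- a, - a) (a, a) :: (real \<times> real) set"
  let ?h = "\<lambda>\<eta>. indicator ?B \<eta> * g \<eta>"
  have "set_integrable lborel (cbox (- a, - a) (a, a)) g"
    unfolding set_integrable_def
    by (intro borel_integrable_compact compact_cbox continuous_on_subset [OF g]) auto
  then have s: "set_integrable lborel ?B g"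
    by (rule set_integrable_subset) (auto simp: box_subset_cbox)
  then have "integrable lborel ?h" by (simp add: set_integrable_def)
  then have i: "integrable (distr lborel borel (mirror2 a \<kappa>)) ?h" by (simp add: distr_mirror2)
  then show "integrable lborel (\<lambda>\<xi>. ?h (mirror2 a \<kappa> \<xi>))"
    by (rule integrable_distr [rotated]) simp
  have m: "?h \<in> borel_measurable borel"
    using borel_measurable_integrable [OF \<open>integrable lborel ?h\<close>] by simp
  have "(LINT \<xi>|lborel. ?h (mirror2 a \<kappa> \<xi>)) = (LINT \<eta>|distr lborel borel (mirror2 a \<kappa>). ?h \<eta>)"
    by (rule integral_distr [symmetric]) (use m in simp_all)
  also have "\<dots> = integral ?B g"
    using set_borel_integral_eq_integral(2) [OF s] by (simp add: distr_mirror2 set_lebesgue_integral_def)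
  finally show "(LINT \<xi>|lborel. ?h (mirror2 a \<kappa> \<xi>)) = face_integral a g"
    by (simp add: face_integral_def integral_open_interval)
qed

lemma other_coords_measurable [measurable]: "other_coords i \<in> borel_measurable borel"
  unfolding other_coords_def
  by (cases "i = 1"; cases "i = 2") (auto intro!: borel_measurable_continuous_onI continuous_intros)

lemma not_images: "n \<notin> images \<Longrightarrow> \<bar>n\<bar> \<ge> 3"
  by (simp add: images_def) presburger

text \<open>Indices outside \<open>images\<close> have size at least 3, and 6a - a - a = 4a.\<close>

lemma far_square:
  fixes a :: real
  assumes "a > 0" "n \<notin> images" "\<bar>u - 2 * of_int n * a\<bar> < a" "\<bar>s\<bar> < a"
  shows "4 * a \<le> \<bar>u - s\<bar>"
proof -
  have "3 \<le> \<bar>of_int n :: real\<bar>" using not_images [OF assms(2)] by linarith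
  then have "3 * a \<le> \<bar>of_int n\<bar> * a" using assms(1) by (intro mult_right_mono) auto
  then have "6 * a \<le> \<bar>2 * of_int n * a\<bar>" using assms(1) by (simp add: abs_mult)
  then show ?thesis using assms(3,4) by linarith
qed

context cube_function
begin

lemma potential_density_continuous: "d \<noteq> 0 \<Longrightarrow> continuous_on UNIV (potential_density i \<sigma> d \<zeta>)"
  unfolding potential_density_def [abs_def] Let_def face_point_def
  by (intro continuous_intros) (use plane_dist_pos [of d 0] in \<open>auto simp: less_le\<close>)

text \<open>Each lateral image contributes on its own square, folded onto the face; the image point
  and the integration point are reflected together, so distances are those between \<open>z\<close>
  and the plane itself. This is what a lateral image sum looks like as one integrand on the
  plane.\<close>

definition unfolded_density :: "3 \<Rightarrow> real \<Rightarrow> real \<Rightarrow> real^3 \<Rightarrow> real \<times> real \<Rightarrow> real" where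
  "unfolded_density i \<sigma> c z \<xi> = (\<Sum>\<kappa>\<in>images \<times> images. parity (fst \<kappa>) * parity (snd \<kappa>) *
     (indicator (box (- a, - a) (a, a)) (mirror2 a \<kappa> \<xi>) *
      potential_density i \<sigma> (c - z $ i) (mirror2 a \<kappa> (other_coords i z)) (mirror2 a \<kappa> \<xi>)))"

lemma unfolded_density_integral:
  assumes "c - z $ i \<noteq> 0"
  shows "integrable lborel (unfolded_density i \<sigma> c z)"
    and "(LINT \<xi>|lborel. unfolded_density i \<sigma> c z \<xi>) = (\<Sum>\<kappa>\<in>images \<times> images. parity (fst \<kappa>) * parity (snd \<kappa>) *
      face_integral a (potential_density i \<sigma> (c - z $ i) (mirror2 a \<kappa> (other_coords i z))))"
  unfolding unfolded_density_def
  using square_integral [OF potential_density_continuous [OF assms]]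
  by (auto intro!: Bochner_Integration.integrable_sum integrable_mult_right simp: Bochner_Integration.integral_sum)

lemma replicated_square:
  assumes "mirror2 a \<kappa> (other_coords i y) \<in> box (- a, - a) (a, a)"
  shows "t * replicated_mean a f i \<sigma> y t =
    parity (fst \<kappa>) * parity (snd \<kappa>) * V0 (face_point i \<sigma> (mirror2 a \<kappa> (other_coords i y))) t"
  unfolding replicated_mean_def E2D_mirror2 [OF a_pos assms] V0_eq face_point_def by simp

lemma replicated_no_square:
  assumes "\<nexists>\<kappa>. mirror2 a \<kappa> (other_coords i y) \<in> box (- a, - a) (a, a)"
  shows "replicated_mean a f i \<sigma> y t = 0"
  unfolding replicated_mean_def E2D_no_square [OF assms] by simp

lemma replicated_differentiable: "(\<lambda>t. t * replicated_mean a f i \<sigma> y t) differentiable (at t)"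
proof (cases "\<exists>\<kappa>. mirror2 a \<kappa> (other_coords i y) \<in> box (- a, - a) (a, a)")
  case True
  then obtain \<kappa> where \<kappa>: "mirror2 a \<kappa> (other_coords i y) \<in> box (- a, - a) (a, a)" by blast
  show ?thesis
    unfolding replicated_square [OF \<kappa>]
    unfolding real_differentiable_def by (blast intro: DERIV_cmult V0_deriv)
next
  case False
  then show ?thesis by (simp add: replicated_no_square)
qed

lemma mean_kernel_unfold:
  assumes z: "z \<in> cube a" and y: "y \<in> coord_plane i c" and \<sigma>: "\<sigma> \<in> {1, -1}"
  shows "indicator (ball z (diameter (cube a))) y * mean_kernel a f i \<sigma> y (dist z y) =
    unfolded_density i \<sigma> c z (other_coords i y)"
proof (cases "\<exists>\<kappa>. mirror2 a \<kappa> (other_coords i y) \<in> box (- a, - a) (a, a)")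
  case False
  then show ?thesis
    by (auto simp: mean_kernel_def replicated_no_square unfolded_density_def intro!: sum.neutral)
next
  case True
  then obtain \<kappa> where \<kappa>: "mirror2 a \<kappa> (other_coords i y) \<in> box (- a, - a) (a, a)" by blast
  let ?\<xi> = "other_coords i y" and ?\<zeta> = "other_coords i z" and ?r = "dist z y"
  let ?w = "face_point i \<sigma> (mirror2 a \<kappa> ?\<xi>)"
  have kernel: "mean_kernel a f i \<sigma> y ?r = parity (fst \<kappa>) * parity (snd \<kappa>) * (V1 ?w ?r / ?r)"
    unfolding mean_kernel_def replicated_square [OF \<kappa>] DERIV_imp_deriv [OF DERIV_cmult [OF V0_deriv]]
    by simp
  have r: "?r = sqrt ((c - z $ i)\<^sup>2 + (norm (?\<xi> - ?\<zeta>))\<^sup>2)"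
  proof -
    have "(norm (y - z))\<^sup>2 = (c - z $ i)\<^sup>2 + (norm (?\<xi> - ?\<zeta>))\<^sup>2"
      using norm_plane_point_diff [of i c ?\<xi> "z $ i" ?\<zeta>] plane_point_other_coords [OF y]
        plane_point_other_coords [of z i "z $ i"] by (simp add: coord_plane_def)
    then show ?thesis by (metis dist_commute dist_norm norm_ge_zero real_sqrt_unique)
  qed
  \<comment> \<open>Reflections are isometries, so every term of the sum involves the same
    distance.\<close>
  then have r': "plane_dist 0 (c - z $ i) (mirror2 a \<kappa>' ?\<zeta>) (mirror2 a \<kappa>' ?\<xi>) = ?r" for \<kappa>'
    by (simp add: plane_dist_def norm_mirror2_diff)
  have "indicator (box (- a, - a) (a, a)) (mirror2 a \<kappa>' ?\<xi>) = (if \<kappa>' = \<kappa> then 1 else 0 :: real)" for \<kappa>'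
  proof (cases "\<kappa>' = \<kappa>")
    case False
    then have "mirror2 a \<kappa>' ?\<xi> \<notin> box (- a, - a) (a, a)"
      using square_unique [OF a_pos \<kappa>] by metis
    with False show ?thesis by simp
  qed (use \<kappa> in simp)
  then have "unfolded_density i \<sigma> c z ?\<xi> = (\<Sum>\<kappa>'\<in>images \<times> images.
      if \<kappa>' = \<kappa> then parity (fst \<kappa>) * parity (snd \<kappa>) * (V1 ?w ?r / ?r) else 0)"
    unfolding unfolded_density_def potential_density_def r' Let_def by (intro sum.cong refl) auto
  also have "\<dots> = (if \<kappa> \<in> images \<times> images then parity (fst \<kappa>) * parity (snd \<kappa>) * (V1 ?w ?r / ?r) else 0)"
    by (simp add: sum.delta')
  finally have u: "unfolded_density i \<sigma> c z ?\<xi> = \<dots>" .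
  show ?thesis
  proof (cases "\<kappa> \<in> images \<times> images")
    case True
    \<comment> \<open>The folded point lies on the closed cube, so the wave there has died out by
      the time the point \<open>y\<close> leaves the ball.\<close>
    have "V1 ?w ?r = 0" if "y \<notin> ball z (diameter (cube a))"
    proof (rule V_vanish)
      show "\<bar>?w $ j\<bar> \<le> a" for j
        using \<kappa> box_subset_cbox \<sigma> by (intro face_point_bound) auto
      show "2 * sqrt 3 * a \<le> \<bar>?r\<bar>"
        using that by (simp add: diameter_cube [OF a_pos] not_less)
    qed
    then show ?thesis
      using True unfolding u kernel by (auto simp: indicator_def)
  next
    case False
    obtain n m p q where nm: "\<kappa> = (n, m)" "?\<xi> = (p, q)" by (cases \<kappa>; cases ?\<xi>)
    obtain s t where st: "?\<zeta> = (s, t)" by (cases ?\<zeta>)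
    have st': "\<bar>s\<bar> < a" "\<bar>t\<bar> < a"
      using st z by (auto simp: other_coords_def cube_def split: if_splits)
    have pq: "\<bar>p - 2 * of_int n * a\<bar> < a" "\<bar>q - 2 * of_int m * a\<bar> < a"
      using \<kappa> by (auto simp: nm mem_square)
    \<comment> \<open>One lateral index lies outside \<open>images\<close>; the gap in that
      coordinate alone already exceeds the diameter.\<close>
    from False have "4 * a \<le> \<bar>p - s\<bar> \<or> 4 * a \<le> \<bar>q - t\<bar>"
      using far_square [OF a_pos _ pq(1) st'(1)] far_square [OF a_pos _ pq(2) st'(2)] by (auto simp: nm)
    moreover have "\<bar>p - s\<bar> \<le> ?r" "\<bar>q - t\<bar> \<le> ?r"
      unfolding r nm st by (auto intro!: real_le_rsqrt simp: norm_Pair)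
    ultimately have "4 * a \<le> ?r" by linarith
    then have "2 * sqrt 3 * a \<le> ?r"
      using far [of ?r 0] a_pos by simp
    then have "y \<notin> ball z (diameter (cube a))"
      by (simp add: diameter_cube [OF a_pos])
    then show ?thesis using False unfolding u by simp
  qed
qed

lemma plane_integral:
  fixes v :: "real^3"
  assumes z: "z \<in> cube a" and \<sigma>: "\<sigma> \<in> {1, -1}" and c: "c \<in> {\<sigma> * a, - 3 * \<sigma> * a}"
  shows "set_integrable (plane_area i c) (coord_plane i c \<inter> ball z (diameter (cube a)))
      (\<lambda>y. mean_kernel a f i \<sigma> y (dist z y) *\<^sub>R v)"
    and "(LINT y : coord_plane i c \<inter> ball z (diameter (cube a)) | plane_area i c.
      mean_kernel a f i \<sigma> y (dist z y) *\<^sub>R v) = (LINT \<xi>|lborel. unfolded_density i \<sigma> c z \<xi>) *\<^sub>R v"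
proof -
  let ?u = "unfolded_density i \<sigma> c z"
  \<comment> \<open>Rewriting the integrand through \<open>unfolded_density\<close> yields
    measurability and integrability without a study of \<open>deriv\<close> as a function of
    \<open>y\<close>.\<close>
  define G where "G y = (indicator (coord_plane i c) y * ?u (other_coords i y)) *\<^sub>R v" for y
  have G: "(\<lambda>y. indicator (coord_plane i c \<inter> ball z (diameter (cube a))) y *\<^sub>R
      mean_kernel a f i \<sigma> y (dist z y) *\<^sub>R v) = G"
  proof
    fix y
    show "indicator (coord_plane i c \<inter> ball z (diameter (cube a))) y *\<^sub>R
      mean_kernel a f i \<sigma> y (dist z y) *\<^sub>R v = G y"
      using mean_kernel_unfold [OF z _ \<sigma>, of y i c]
      by (cases "y \<in> coord_plane i c") (auto simp: G_def indicator_inter_arith mult.assoc)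
  qed
  have u: "integrable lborel ?u"
    by (rule unfolded_density_integral) (rule offset_nonzero [OF z c \<sigma>])
  have um [measurable]: "?u \<in> borel_measurable borel"
    using borel_measurable_integrable [OF u] by simp
  have "closed (coord_plane i c)"
    unfolding coord_plane_def by (intro closed_Collect_eq continuous_intros)
  then have [measurable]: "coord_plane i c \<in> sets borel" by (rule borel_closed)
  have Gm: "G \<in> borel_measurable borel"
    unfolding G_def [abs_def] by measurable
  have Gp: "G (plane_point i c \<xi>) = ?u \<xi> *\<^sub>R v" for \<xi>
    by (simp add: G_def coord_plane_def)
  have "integrable (plane_area i c) G"
    unfolding plane_area_def by (subst integrable_distr_eq) (use Gm u in \<open>auto simp: Gp\<close>)
  then show "set_integrable (plane_area i c) (coord_plane i c \<inter> ball z (diameter (cube a)))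
      (\<lambda>y. mean_kernel a f i \<sigma> y (dist z y) *\<^sub>R v)"
    unfolding set_integrable_def G .
  have "(LINT y|plane_area i c. G y) = (LINT \<xi>|lborel. ?u \<xi> *\<^sub>R v)"
    unfolding plane_area_def by (subst integral_distr) (use Gm in \<open>auto simp: Gp\<close>)
  also have "\<dots> = (LINT \<xi>|lborel. ?u \<xi>) *\<^sub>R v"
    using u by (intro integral_scaleR_left) auto
  finally show "(LINT y : coord_plane i c \<inter> ball z (diameter (cube a)) | plane_area i c.
      mean_kernel a f i \<sigma> y (dist z y) *\<^sub>R v) = (LINT \<xi>|lborel. ?u \<xi>) *\<^sub>R v"
    unfolding set_lebesgue_integral_def G .
qed

text \<open>The normals are signed coordinate vectors, so component \<open>i\<close> receives only
  the two faces orthogonal to axis \<open>i\<close>, with weight \<sigma>; the lateral sum is then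
  moved outermost to match \<open>layer_sum\<close>.\<close>

lemma plane_potential_eq:
  assumes z: "z \<in> cube a"
  shows "plane_potential a f z $ i =
    layer_sum z i (\<lambda>i \<sigma> d \<zeta>. face_integral a (potential_density i \<sigma> d \<zeta>))"
proof -
  define I where "I j \<sigma> c = (LINT \<xi>|lborel. unfolded_density j \<sigma> c z \<xi>)" for j \<sigma> c
  have pp: "plane_potential a f z = (\<Sum>(j, \<sigma>) \<in> UNIV \<times> {1, -1}. \<Sum>c \<in> {\<sigma> * a, - 3 * \<sigma> * a}.
      I j \<sigma> c *\<^sub>R face_normal j \<sigma>)"
    unfolding plane_potential_def
    by (intro sum.cong refl) (auto simp: I_def intro!: sum.cong plane_integral(2) [OF z])
  have "plane_potential a f z $ i = (\<Sum>j\<in>UNIV. \<Sum>\<sigma>\<in>{1, -1}. \<Sum>c \<in> {\<sigma> * a, - 3 * \<sigma> * a}.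
      if i = j then \<sigma> * I i \<sigma> c else 0)"
  proof -
    have "(I j \<sigma> c *\<^sub>R face_normal j \<sigma>) $ i = (if i = j then \<sigma> * I i \<sigma> c else 0)" for j \<sigma> c
      by (simp add: face_normal_def axis_def)
    then show ?thesis
      unfolding pp sum.cartesian_product [symmetric] sum_component by simp
  qed
  also have "\<dots> = (\<Sum>j\<in>UNIV. if i = j then \<Sum>\<sigma>\<in>{1, -1}. \<sigma> * (\<Sum>c \<in> {\<sigma> * a, - 3 * \<sigma> * a}. I i \<sigma> c) else 0)"
  proof (rule sum.cong [OF refl])
    fix j
    show "(\<Sum>\<sigma>\<in>{1, -1}. \<Sum>c \<in> {\<sigma> * a, - 3 * \<sigma> * a}. if i = j then \<sigma> * I i \<sigma> c else 0) =
        (if i = j then \<Sum>\<sigma>\<in>{1, -1}. \<sigma> * (\<Sum>c \<in> {\<sigma> * a, - 3 * \<sigma> * a}. I i \<sigma> c) else 0)"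
    proof (cases "i = j")
      case True
      show ?thesis unfolding if_P [OF True] by (intro sum.cong sum_distrib_left [symmetric] refl)
    next
      case False
      show ?thesis unfolding if_not_P [OF False] by (intro sum.neutral ballI refl)
    qed
  qed
  also have "\<dots> = (\<Sum>\<sigma>\<in>{1, -1}. \<sigma> * (\<Sum>c \<in> {\<sigma> * a, - 3 * \<sigma> * a}. I i \<sigma> c))"
    by (simp only: sum.delta' finite UNIV_I if_True)
  also have "\<dots> = (\<Sum>\<sigma>\<in>{1, -1}. \<sigma> * (\<Sum>c \<in> {\<sigma> * a, - 3 * \<sigma> * a}.
      \<Sum>\<kappa>\<in>images \<times> images. parity (fst \<kappa>) * parity (snd \<kappa>) *
      face_integral a (potential_density i \<sigma> (c - z $ i) (mirror2 a \<kappa> (other_coords i z)))))"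
    unfolding I_def
    by (intro sum.cong refl arg_cong2 [where f = "(*)"] unfolded_density_integral(2) offset_nonzero [OF z])
  also have "\<dots> = layer_sum z i (\<lambda>i \<sigma> d \<zeta>. face_integral a (potential_density i \<sigma> d \<zeta>))"
  proof -
    have "(\<Sum>\<sigma>\<in>{1, -1}. \<Sum>c \<in> {\<sigma> * a, - 3 * \<sigma> * a}. \<Sum>\<kappa>\<in>images \<times> images. g \<sigma> c \<kappa>) =
        (\<Sum>\<kappa>\<in>images \<times> images. \<Sum>\<sigma>\<in>{1, -1}. \<Sum>c \<in> {\<sigma> * a, - 3 * \<sigma> * a}. g \<sigma> c \<kappa>)" for g :: "real \<Rightarrow> real \<Rightarrow> int \<times> int \<Rightarrow> real"
      by (rule trans [OF _ sum.swap]) (intro sum.cong refl sum.swap)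
    then show ?thesis
      unfolding layer_sum_def sum_distrib_left by (simp only: mult_ac)
  qed
  finally show ?thesis .
qed

text \<open>The potential is known as a layer sum only for points of the cube; the cube being open,
  this covers a neighbourhood of \<open>s = 0\<close> on the line.\<close>

lemma deriv_plane_potential:
  assumes x: "x \<in> cube a"
  shows "((\<lambda>s. plane_potential a f (x + s *\<^sub>R axis i 1) $ i) has_real_derivative
    layer_sum x i (\<lambda>i \<sigma> d \<zeta>. d * face_integral a (layer_deriv i \<sigma> d \<zeta>))) (at 0)"
proof (rule has_field_derivative_transform_within_open [OF deriv_layer_potential [OF x]])
  show "open ((\<lambda>s. x + s *\<^sub>R axis i 1) -` cube a)"
    by (intro open_vimage open_cube continuous_intros)
  show "0 \<in> (\<lambda>s. x + s *\<^sub>R axis i 1) -` cube a" using x by simp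
qed (simp add: plane_potential_eq)

end

text \<open>\<open>deriv\<close> and the Lebesgue integral are total, with arbitrary or default
  values where they are meaningless. Differentiability and integrability therefore belong to the
  conclusion, so that the formula speaks of genuine derivatives and integrals.\<close>

theorem theorem3:
  fixes a :: real and f :: "real^3 \<Rightarrow> real" and x :: "real^3"
  assumes "a > 0"
    and "C2_compact_support f (cube a)"
    and "x \<in> cube a"
  shows
    "(\<forall>i. \<forall>\<sigma> \<in> {1, -1}. \<forall>c \<in> {\<sigma> * a, - 3 * \<sigma> * a}.
        (\<forall>y \<in> coord_plane i c \<inter> ball x (diameter (cube a)).
           (\<lambda>t. t * replicated_mean a f i \<sigma> y t) differentiable (at (dist x y))) \<and>
        set_integrable (plane_area i c) (coord_plane i c \<inter> ball x (diameter (cube a)))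
          (\<lambda>y. mean_kernel a f i \<sigma> y (dist x y) *\<^sub>R face_normal i \<sigma>)) \<and>
     (\<forall>i. partial_differentiable (\<lambda>z. plane_potential a f z $ i) i x) \<and>
     f x = 1 / (2 * pi) * divergence (plane_potential a f) x"
proof -
  obtain f1 f2 where "\<And>x. (f has_derivative blinfun_apply (f1 x)) (at x)"
    "\<And>x. (f1 has_derivative blinfun_apply (f2 x)) (at x)"
    "continuous_on UNIV f2" "\<And>x. x \<notin> cube a \<Longrightarrow> f x = 0 \<and> f1 x = 0 \<and> f2 x = 0"
    using C2_compact_support_extend [OF assms(2)] by blast
  then interpret cube_function f f1 f2 a
    using \<open>a > 0\<close> by unfold_locales auto
  note d = deriv_plane_potential [OF \<open>x \<in> cube a\<close>]
  have "divergence (plane_potential a f) x = 2 * pi * f x"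
    unfolding divergence_def partial_deriv_def DERIV_imp_deriv [OF d]
    by (rule inversion_layers [OF \<open>x \<in> cube a\<close>, symmetric])
  moreover have "partial_differentiable (\<lambda>z. plane_potential a f z $ i) i x" for i
    unfolding partial_differentiable_def real_differentiable_def using d by blast
  ultimately show ?thesis
    using replicated_differentiable plane_integral(1) [OF \<open>x \<in> cube a\<close>] by auto
qed

end
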